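(* For every $k\in\mathbb{N}$ there exists a constant $C_k>0$, depending only on $k$, such that for all $n\in\mathbb{N}$ and all $\mathbf{x}=(x_1,\dots,x_k)\in\mathbb{T}_0^k$ and $\mathbf{y}=(y_1,\dots,y_k)\in\mathbb{T}_0^k$, $$p_k(\mathbf{x},\mathbf{y})\le C_k\, n^{2k},$$ where $$p_k(\mathbf{x},\mathbf{y}):=\frac{\mathbb{E}\Big[\prod_{j=1}^k |X'(x_j)|\,|Y'(y_j)|\ \Big|\ X(x_i)=Y(y_i)=0 \text{ for all } i\in\{1,\dots,k\}\Big]}{(2\pi)^k\det(\Sigma)^{1/2}}.$$
   Context: Let $\varepsilon_0,\dots,\varepsilon_n$ be i.i.d. standard (real) Gaussian random variables and set $X(x)=\sum_{j=0}^n\varepsilon_j\cos(jx)$, $Y(x)=\sum_{j=0}^n\varepsilon_j\sin(jx)$ (the same $\varepsilon_j$ in both). Primes denote derivatives in $x$. Set $\mathbb{T}_0=\{x\in[0,\pi]: d(x,\{0,\pi\})>n^{-1/2}\}$ (depending on $n$), where $d$ denotes distance. $\Sigma$ is the $2k\times 2k$ covariance matrix of the Gaussian vector $(X(x_1),\dots,X(x_k),Y(y_1),\dots,Y(y_k))$. Conditioning is the usual conditioning of jointly Gaussian vectors on the values of other coordinates. If $x_i=x_j$ or $y_i=y_j$ for some $i\neq j$, then $\Sigma$ is singular, and by convention $p_k(\mathbf{x},\mathbf{y})=0$.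
   Formalization: For k ≥ 2 the finitely many n with 2k ≤ n ≤ 4k−2 are excluded: there Σ can be singular at points with distinct coordinates and p_k is unbounded nearby (e.g. k=2, n=4). n starts at 1, and p_k is set to 0 wherever Σ is singular. *)

theory Defs
  imports
    "HOL-Probability.Probability"
    "Jordan_Normal_Form.Determinant"
    "Jordan_Normal_Form.Gauss_Jordan_Elimination"
begin

definition iid_std_gaussian :: "'a measure \<Rightarrow> nat set \<Rightarrow> (nat \<Rightarrow> 'a \<Rightarrow> real) \<Rightarrow> bool" where
  "iid_std_gaussian M J \<epsilon> \<longleftrightarrow>
     prob_space M \<and>
     prob_space.indep_vars M (\<lambda>_. borel) \<epsilon> J \<and>
     (\<forall>j\<in>J. distributed M lborel (\<epsilon> j) std_normal_density)"

definition cos_poly :: "nat \<Rightarrow> (nat \<Rightarrow> 'a \<Rightarrow> real) \<Rightarrow> real \<Rightarrow> 'a \<Rightarrow> real" where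
  "cos_poly n \<epsilon> t \<omega> = (\<Sum>j=0..n. \<epsilon> j \<omega> * cos (real j * t))"

definition sin_poly :: "nat \<Rightarrow> (nat \<Rightarrow> 'a \<Rightarrow> real) \<Rightarrow> real \<Rightarrow> 'a \<Rightarrow> real" where
  "sin_poly n \<epsilon> t \<omega> = (\<Sum>j=0..n. \<epsilon> j \<omega> * sin (real j * t))"

definition T0 :: "nat \<Rightarrow> real set" where
  "T0 n = {t \<in> {0..pi}. infdist t {0, pi} > real n powr (-1/2)}"

text \<open>
  A random vector of dimension \<open>m\<close> is a family \<open>V :: nat \<Rightarrow> 'a \<Rightarrow> real\<close> of which only the
  components \<open>V 0, \<dots>, V (m - 1)\<close> are relevant.
\<close>

definition covariance :: "'a measure \<Rightarrow> ('a \<Rightarrow> real) \<Rightarrow> ('a \<Rightarrow> real) \<Rightarrow> real" where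
  "covariance M f g =
     (LINT \<omega>|M. (f \<omega> - (LINT \<omega>'|M. f \<omega>')) * (g \<omega> - (LINT \<omega>'|M. g \<omega>')))"

definition cross_cov_mat ::
  "'a measure \<Rightarrow> nat \<Rightarrow> (nat \<Rightarrow> 'a \<Rightarrow> real) \<Rightarrow> nat \<Rightarrow> (nat \<Rightarrow> 'a \<Rightarrow> real) \<Rightarrow> real mat" where
  "cross_cov_mat M a U b V = Matrix.mat a b (\<lambda>(i, j). covariance M (U i) (V j))"

abbreviation cov_mat :: "'a measure \<Rightarrow> nat \<Rightarrow> (nat \<Rightarrow> 'a \<Rightarrow> real) \<Rightarrow> real mat" where
  "cov_mat M m V \<equiv> cross_cov_mat M m V m V"

text \<open>
  The conditional expectation \<open>E[f(U) | V = v]\<close> for a jointly Gaussian pair \<open>(U, V)\<close> of dimensions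
  \<open>a\<close> and \<open>b\<close>, where \<open>V\<close> has an invertible covariance matrix. With
  \<open>A = Cov(U,V) Cov(V,V)\<^sup>-\<^sup>1\<close>, the vector \<open>U - A V\<close> is uncorrelated with \<open>V\<close>, hence independent of
  it, so that the law of \<open>U\<close> given \<open>V = v\<close> is the law of \<open>(U - A V) + A v\<close>; this is the Gaussian law
  with mean \<open>E U + A (v - E V)\<close> and covariance \<open>Cov(U,U) - A Cov(V,U)\<close>. The event \<open>V = v\<close> has
  probability zero, and this is the version of the conditional law that depends continuously on \<open>v\<close>.
\<close>

definition gaussian_cond_exp ::
  "'a measure \<Rightarrow> nat \<Rightarrow> (nat \<Rightarrow> 'a \<Rightarrow> real) \<Rightarrow> nat \<Rightarrow> (nat \<Rightarrow> 'a \<Rightarrow> real) \<Rightarrow> (nat \<Rightarrow> real)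
     \<Rightarrow> ((nat \<Rightarrow> real) \<Rightarrow> real) \<Rightarrow> real" where
  "gaussian_cond_exp M a U b V v f =
     (let A = cross_cov_mat M a U b V * the (mat_inverse (cov_mat M b V))
      in LINT \<omega>|M. f (\<lambda>i. U i \<omega> + (\<Sum>j<b. A $$ (i, j) * (v j - V j \<omega>))))"

definition value_vec ::
  "nat \<Rightarrow> (nat \<Rightarrow> 'a \<Rightarrow> real) \<Rightarrow> nat \<Rightarrow> (nat \<Rightarrow> real) \<Rightarrow> (nat \<Rightarrow> real) \<Rightarrow> nat \<Rightarrow> 'a \<Rightarrow> real" where
  "value_vec n \<epsilon> k x y i \<omega> =
     (if i < k then cos_poly n \<epsilon> (x i) \<omega> else sin_poly n \<epsilon> (y (i - k)) \<omega>)"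

definition deriv_vec ::
  "nat \<Rightarrow> (nat \<Rightarrow> 'a \<Rightarrow> real) \<Rightarrow> nat \<Rightarrow> (nat \<Rightarrow> real) \<Rightarrow> (nat \<Rightarrow> real) \<Rightarrow> nat \<Rightarrow> 'a \<Rightarrow> real" where
  "deriv_vec n \<epsilon> k x y i \<omega> =
     (if i < k then deriv (\<lambda>t. cos_poly n \<epsilon> t \<omega>) (x i)
      else deriv (\<lambda>t. sin_poly n \<epsilon> t \<omega>) (y (i - k)))"

text \<open>
  The points are \<open>x 0, \<dots>, x (k - 1)\<close> and \<open>y 0, \<dots>, y (k - 1)\<close>. If the covariance matrix is singular
  although the \<open>x i\<close> are distinct and the \<open>y i\<close> are distinct, the value is 0 as well, because
  division by zero yields 0. For \<open>n \<ge> 4 k - 1\<close> this does not happen for points in \<open>(0, pi)\<close>. For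
  \<open>k \<ge> 2\<close> and \<open>2 k \<le> n \<le> 4 k - 2\<close> it does: the matrix is singular whenever all
  \<open>cos ((2 k - 1) x i)\<close> and all \<open>sin ((2 k - 1) y i)\<close> vanish. The quotient can then be unbounded:
  for \<open>k = 2\<close>, \<open>n = 4\<close>, take \<open>x = (a, pi - a)\<close>, \<open>y = (b, pi - b)\<close> and let
  \<open>(cos b)\<^sup>2\<close> tend to \<open>(cos a)\<^sup>2 - 1/2 = 1/5\<close>.
\<close>

definition zero_density ::
  "'a measure \<Rightarrow> nat \<Rightarrow> (nat \<Rightarrow> 'a \<Rightarrow> real) \<Rightarrow> nat \<Rightarrow> (nat \<Rightarrow> real) \<Rightarrow> (nat \<Rightarrow> real) \<Rightarrow> real" where
  "zero_density M n \<epsilon> k x y =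
     (if \<exists>i<k. \<exists>j<k. i \<noteq> j \<and> (x i = x j \<or> y i = y j) then 0
      else
        gaussian_cond_exp M (2 * k) (deriv_vec n \<epsilon> k x y) (2 * k) (value_vec n \<epsilon> k x y) (\<lambda>_. 0)
          (\<lambda>u. \<Prod>j<k. \<bar>u j\<bar> * \<bar>u (k + j)\<bar>)
        / ((2 * pi) ^ k * sqrt (Determinant.det (cov_mat M (2 * k) (value_vec n \<epsilon> k x y)))))"

end

theory Submission
  imports Defs
begin

text \<open>
  The zeros are linear conditions on the coefficient vector: with \<open>a i\<close> the vectors
  \<open>(cos (l x i))\<close> and \<open>(sin (l y i))\<close> and \<open>b i\<close> their derivatives, \<open>sqrt (det \<Sigma>)\<close> is the product of the
  norms of the Gram-Schmidt vectors of \<open>a\<close>, and the conditional expectation is at most a constant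
  times the product of the norms of the residuals of \<open>b i\<close> modulo the span of all \<open>a j\<close>. So it
  suffices that each residual is at most \<open>C n\<close> times the corresponding Gram-Schmidt vector.

  For the cosines alone, let \<open>D\<close> be the discrete Duhamel operator of the frequency \<open>x\<close>, the adjoint
  of multiplying trigonometric polynomials vanishing at \<open>x\<close> by \<open>sin x / (cos t - cos x)\<close>. It has
  norm \<open>O(n)\<close>, maps \<open>cos (l t)\<close> into the span of \<open>cos (l t)\<close> and \<open>cos (l x)\<close>, and maps \<open>cos (l x)\<close> to
  minus its derivative. Applied to \<open>cos (l x)\<close> minus a combination of earlier cosines it therefore
  bounds the residual; the same holds for sines. To remove the cosines from the Gram-Schmidt vector
  of a sine, extend it to \<open>-n, \<dots>, n\<close> as an exponential sum with \<open>4 k\<close> frequencies: as in Turan's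
  lemma its energy on \<open>-n, \<dots>, n\<close> is comparable to that on \<open>0, \<dots>, n\<close> when \<open>4 k \<le> n + 1\<close>, and the sine
  combination is its odd part. For \<open>k = 1\<close>, \<open>n = 2\<close> the
  coordinate \<open>l = 0\<close>, where sines vanish, bounds the cosine coefficient instead. For \<open>n < 2 k\<close> a regular \<open>\<Sigma>\<close> forces all residuals to vanish.
\<close>

section \<open>Linear recurrences with trigonometric solutions\<close>

text \<open>\<open>duhamel x a\<close> is the solution of the recurrence in
  \<open>duhamel_rec\<close> with forcing \<open>2 * sin x * a (j + 1)\<close> and initial values
  \<open>0\<close> and \<open>sin x * a 0\<close>. The entry \<open>a 0\<close> has weight 1 instead
  of 2, as \<open>duhamel_cos\<close> requires at \<open>j = 1\<close>.\<close>

definition duhamel :: "real \<Rightarrow> (nat \<Rightarrow> real) \<Rightarrow> nat \<Rightarrow> real" where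
  "duhamel x a j = sin (real j * x) * a 0 + 2 * (\<Sum>l = 1..j. sin ((real j - real l) * x) * a l)"

lemma duhamel_0 [simp]: "duhamel x a 0 = 0"
  by (simp add: duhamel_def)

lemma duhamel_1 [simp]: "duhamel x a (Suc 0) = sin x * a 0"
  by (simp add: duhamel_def)

lemma duhamel_rec:
  "duhamel x a (Suc (Suc j)) =
     2 * cos x * duhamel x a (Suc j) - duhamel x a j + 2 * sin x * a (Suc j)"
proof -
  have trig: "sin (u + 2 * x) = 2 * cos x * sin (u + x) - sin u" for u :: real
    using sin_add[of "u + x" x] sin_diff[of "u + x" x] by (simp add: algebra_simps)
  \<comment> \<open>\<open>S d\<close> keeps the summation range of index \<open>j\<close> and
    advances the kernel by \<open>d\<close> steps. Of the terms beyond that range only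
    \<open>sin x * a (j + 1)\<close> survives, the others having the factor
    \<open>sin 0\<close>.\<close>
  define S where "S d = (\<Sum>l = 1..j. sin ((real j - real l) * x + d * x) * a l)" for d
  have S2: "S 2 = 2 * cos x * S 1 - S 0"
    unfolding S_def sum_distrib_left sum_subtractf[symmetric] trig
    by (intro sum.cong refl) (simp add: algebra_simps)
  have d2: "duhamel x a (Suc (Suc j)) =
      sin (real j * x + 2 * x) * a 0 + 2 * (S 2 + sin x * a (Suc j))"
    by (simp add: duhamel_def S_def algebra_simps)
  have d1: "duhamel x a (Suc j) = sin (real j * x + x) * a 0 + 2 * S 1"
    by (simp add: duhamel_def S_def algebra_simps)
  have d0: "duhamel x a j = sin (real j * x) * a 0 + 2 * S 0"
    by (simp add: duhamel_def S_def algebra_simps)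
  show ?thesis
    unfolding d0 d1 d2 S2 trig by (simp add: algebra_simps)
qed

lemma duhamel_diff: "duhamel x (\<lambda>l. a l - b l) j = duhamel x a j - duhamel x b j"
  by (simp add: duhamel_def algebra_simps sum_subtractf)

lemma duhamel_sum:
  "duhamel x (\<lambda>l. \<Sum>i\<in>I. c i * a i l) j = (\<Sum>i\<in>I. c i * duhamel x (a i) j)"
proof -
  have "(\<Sum>l = 1..j. sin ((real j - real l) * x) * (\<Sum>i\<in>I. c i * a i l)) =
      (\<Sum>i\<in>I. c i * (\<Sum>l = 1..j. sin ((real j - real l) * x) * a i l))"
    unfolding sum_distrib_left by (subst sum.swap) (simp add: mult.left_commute)
  thus ?thesis
    by (simp add: duhamel_def sum_distrib_left sum.distrib algebra_simps)
qed

lemma trig_rec: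
  fixes t :: real
  shows "cos (real (Suc (Suc j)) * t) = 2 * cos t * cos (real (Suc j) * t) - cos (real j * t)"
    and "sin (real (Suc (Suc j)) * t) = 2 * cos t * sin (real (Suc j) * t) - sin (real j * t)"
proof -
  have *: "real (Suc (Suc j)) * t = real (Suc j) * t + t" "real j * t = real (Suc j) * t - t"
    by (simp_all add: algebra_simps)
  show "cos (real (Suc (Suc j)) * t) = 2 * cos t * cos (real (Suc j) * t) - cos (real j * t)"
    unfolding * cos_add cos_diff by simp
  show "sin (real (Suc (Suc j)) * t) = 2 * cos t * sin (real (Suc j) * t) - sin (real j * t)"
    unfolding * sin_add sin_diff by simp
qed

text \<open>The closed forms of \<open>duhamel\<close> below follow from two initial values and the
  recurrence, with \<open>h\<close> as the forcing.\<close>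

lemma two_step_unique:
  fixes f g h :: "nat \<Rightarrow> real"
  assumes "f 0 = g 0" "f (Suc 0) = g (Suc 0)"
    and "\<And>j. f (Suc (Suc j)) = c * f (Suc j) - f j + h j"
    and "\<And>j. g (Suc (Suc j)) = c * g (Suc j) - g j + h j"
  shows "f j = g j"
proof -
  have "f j = g j \<and> f (Suc j) = g (Suc j)"
    by (induction j) (use assms in auto)
  thus ?thesis ..
qed

text \<open>Since \<open>cos (j t)\<close> obeys the recurrence with \<open>2 cos t\<close> in place
  of \<open>2 cos x\<close>, its defect is a multiple of \<open>cos t - cos x\<close>, which matches
  the forcing. Keeping that factor on the left avoids a division.\<close>

lemma duhamel_cos:
  "(cos t - cos x) * duhamel x (\<lambda>l. cos (real l * t)) j = sin x * (cos (real j * t) - cos (real j * x))"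
  by (rule two_step_unique[where c = "2 * cos x" and
        h = "\<lambda>j. (cos t - cos x) * (2 * sin x * cos (real (Suc j) * t))"])
     (simp_all only: duhamel_rec trig_rec, simp_all add: algebra_simps)

text \<open>This is the limit \<open>t -> x\<close> of \<open>duhamel_cos\<close>; the right-hand
  side is minus the derivative of \<open>cos (j x)\<close> in \<open>x\<close>.\<close>

lemma duhamel_cos_same:
  "duhamel x (\<lambda>l. cos (real l * x)) j = real j * sin (real j * x)"
proof (rule two_step_unique[where c = "2 * cos x" and
        h = "\<lambda>j. 2 * sin x * cos (real (Suc j) * x)"])
  fix j
  have "sin (real j * x) = sin (real (Suc j) * x - x)"
    by (simp add: algebra_simps)
  hence "sin (real j * x) = sin (real (Suc j) * x) * cos x - cos (real (Suc j) * x) * sin x"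
    unfolding sin_diff .
  thus "real (Suc (Suc j)) * sin (real (Suc (Suc j)) * x) =
      2 * cos x * (real (Suc j) * sin (real (Suc j) * x)) - real j * sin (real j * x) +
      2 * sin x * cos (real (Suc j) * x)"
    unfolding trig_rec by (simp add: algebra_simps del: of_nat_Suc) (simp add: algebra_simps)
qed (simp_all only: duhamel_rec, simp_all)

lemma duhamel_sin:
  "(cos t - cos x) * duhamel x (\<lambda>l. sin (real l * t)) j =
     sin x * sin (real j * t) - sin t * sin (real j * x)"
  by (rule two_step_unique[where c = "2 * cos x" and
        h = "\<lambda>j. (cos t - cos x) * (2 * sin x * sin (real (Suc j) * t))"])
     (simp_all only: duhamel_rec trig_rec, simp_all add: algebra_simps)

text \<open>This is the limit \<open>t -> x\<close> of \<open>duhamel_sin\<close>. The factor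
  \<open>sin t\<close> there varies too, which adds a multiple of \<open>sin (j x)\<close> to minus
  the derivative; \<open>\<kappa>\<close> in \<open>residual_le_duhamel\<close> takes care of
  it.\<close>

lemma duhamel_sin_same:
  "sin x * duhamel x (\<lambda>l. sin (real l * x)) j =
     cos x * sin (real j * x) - real j * (sin x * cos (real j * x))"
proof (rule two_step_unique[where c = "2 * cos x" and
        h = "\<lambda>j. sin x * (2 * sin x * sin (real (Suc j) * x))"])
  fix j
  have "cos (real j * x) = cos (real (Suc j) * x - x)"
    by (simp add: algebra_simps)
  hence "cos (real j * x) = cos (real (Suc j) * x) * cos x + sin (real (Suc j) * x) * sin x"
    unfolding cos_diff .
  thus "cos x * sin (real (Suc (Suc j)) * x) - real (Suc (Suc j)) * (sin x * cos (real (Suc (Suc j)) * x)) =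
      2 * cos x * (cos x * sin (real (Suc j) * x) - real (Suc j) * (sin x * cos (real (Suc j) * x))) -
      (cos x * sin (real j * x) - real j * (sin x * cos (real j * x))) +
      sin x * (2 * sin x * sin (real (Suc j) * x))"
    unfolding trig_rec by (simp add: algebra_simps del: of_nat_Suc) (simp add: algebra_simps)
qed (simp_all only: duhamel_rec, simp_all add: algebra_simps)

text \<open>By Cauchy-Schwarz each entry is at most \<open>2 * sqrt (n + 1)\<close> times the norm
  of \<open>a\<close>; the norm over \<open>n + 1\<close> entries contributes the second
  \<open>sqrt (n + 1)\<close>.\<close>

lemma L2_set_duhamel_le:
  "L2_set (duhamel x a) {..n} \<le> 2 * (real n + 1) * L2_set a {..n}"
proof -
  have const: "L2_set (\<lambda>_. c) {..n} = sqrt (real n + 1) * c" if "0 \<le> c" for c :: real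
    using that by (simp add: L2_set_def real_sqrt_mult add.commute)
  have "\<bar>duhamel x a j\<bar> \<le> 2 * (sqrt (real n + 1) * L2_set a {..n})" if "j \<le> n" for j
  proof -
    have "\<bar>duhamel x a j\<bar> \<le> \<bar>sin (real j * x) * a 0\<bar> +
        2 * (\<Sum>l = 1..j. \<bar>sin ((real j - real l) * x) * a l\<bar>)"
      unfolding duhamel_def
      using sum_abs[of "\<lambda>l. sin ((real j - real l) * x) * a l" "{1..j}"] by linarith
    \<comment> \<open>The weight of \<open>a 0\<close> is raised to 2 so that one sum over all
      \<open>l \<le> j\<close> remains.\<close>
    also have "\<dots> \<le> 2 * \<bar>a 0\<bar> + 2 * (\<Sum>l = 1..j. \<bar>a l\<bar>)"
    proof -
      have b: "\<bar>sin u * v\<bar> \<le> \<bar>v\<bar>" for u v :: real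
        by (simp add: abs_mult mult_left_le_one_le)
      have "(\<Sum>l = 1..j. \<bar>sin ((real j - real l) * x) * a l\<bar>) \<le> (\<Sum>l = 1..j. \<bar>a l\<bar>)"
        by (intro sum_mono b)
      with b[of "real j * x" "a 0"] show ?thesis
        by linarith
    qed
    also have "\<dots> = 2 * (\<Sum>l\<le>j. \<bar>a l\<bar>)"
      by (simp add: atMost_atLeast0 sum.atLeast_Suc_atMost)
    also have "(\<Sum>l\<le>j. \<bar>a l\<bar>) \<le> (\<Sum>l\<le>n. \<bar>1\<bar> * \<bar>a l\<bar>)"
      using that by (simp add: sum_mono2)
    also have "\<dots> \<le> L2_set (\<lambda>_. 1) {..n} * L2_set a {..n}"
      by (rule L2_set_mult_ineq)
    also have "L2_set (\<lambda>_. 1) {..n} = sqrt (real n + 1)"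
      by (simp add: L2_set_def)
    finally show ?thesis by simp
  qed
  hence "L2_set (\<lambda>j. \<bar>duhamel x a j\<bar>) {..n} \<le> L2_set (\<lambda>_. 2 * (sqrt (real n + 1) * L2_set a {..n})) {..n}"
    by (intro L2_set_mono) auto
  also have "\<dots> = sqrt (real n + 1) * (2 * (sqrt (real n + 1) * L2_set a {..n}))"
    using const[of "2 * (sqrt (real n + 1) * L2_set a {..n})"] by (simp add: L2_set_nonneg)
  also have "\<dots> = 2 * (real n + 1) * L2_set a {..n}"
    by (simp add: algebra_simps)
  finally show ?thesis by (simp add: L2_set_def)
qed

section \<open>A Turan-type comparison of energies\<close>

text \<open>In blocks of length \<open>m\<close>, the recurrence writes each block entrywise in
  terms of the \<open>N\<close> preceding ones. By Cauchy-Schwarz its energy is at most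
  \<open>N K^2\<close> times theirs, so appending one block multiplies the total energy by at most
  \<open>1 + N K^2\<close>.\<close>

lemma block_extension:
  fixes h :: "nat \<Rightarrow> real"
  assumes rec: "\<And>l. h (l + N * m) = - (\<Sum>q<N. c q * h (l + q * m))"
    and c: "\<And>q. q < N \<Longrightarrow> \<bar>c q\<bar> \<le> K"
  shows "(\<Sum>l<(N + p) * m. (h l)\<^sup>2) \<le> (1 + real N * K\<^sup>2) ^ p * (\<Sum>l<N * m. (h l)\<^sup>2)"
proof (induction p)
  case (Suc p)
  define B where "B q = (\<Sum>l<m. (h (l + q * m))\<^sup>2)" for q
  have blocks: "(\<Sum>l<M * m. (h l)\<^sup>2) = (\<Sum>q<M. B q)" for M
  proof -
    have "sum f {s..<s + m} = (\<Sum>l<m. f (l + s))" for f :: "nat \<Rightarrow> real" and s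
      using sum.shift_bounds_nat_ivl[of f 0 s m] by (simp add: lessThan_atLeast0 add.commute)
    thus ?thesis
      by (simp add: B_def flip: sum.nat_group)
  qed
  have pt: "(h (l + (p + N) * m))\<^sup>2 \<le> real N * K\<^sup>2 * (\<Sum>q<N. (h (l + (p + q) * m))\<^sup>2)" for l
  proof -
    have "(h (l + (p + N) * m))\<^sup>2 = (\<Sum>q<N. c q * h (l + (p + q) * m))\<^sup>2"
      using rec[of "l + p * m"] by (simp add: algebra_simps)
    also have "\<dots> \<le> (\<Sum>q<N. (c q)\<^sup>2) * (\<Sum>q<N. (h (l + (p + q) * m))\<^sup>2)"
      by (rule Cauchy_Schwarz_ineq_sum)
    also have "(\<Sum>q<N. (c q)\<^sup>2) \<le> (\<Sum>q<N. K\<^sup>2)"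
      using c by (intro sum_mono) (simp add: abs_le_square_iff[symmetric], smt (verit))
    finally show ?thesis by (simp add: mult_right_mono sum_nonneg)
  qed
  have "B (p + N) \<le> (\<Sum>l<m. real N * K\<^sup>2 * (\<Sum>q<N. (h (l + (p + q) * m))\<^sup>2))"
    unfolding B_def by (intro sum_mono pt)
  also have "\<dots> = real N * K\<^sup>2 * (\<Sum>q<N. B (p + q))"
    unfolding B_def sum_distrib_left[symmetric] by (subst sum.swap) simp
  also have "(\<Sum>q<N. B (p + q)) = sum B {p..<p + N}"
    using sum.shift_bounds_nat_ivl[of B 0 p N] by (simp add: lessThan_atLeast0 add.commute)
  also have "\<dots> \<le> (\<Sum>q<N + p. B q)"
    by (intro sum_mono2) (auto simp: B_def intro: sum_nonneg)
  finally have step: "B (N + p) \<le> real N * K\<^sup>2 * (\<Sum>q<N + p. B q)"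
    by (simp add: mult_left_mono add.commute)
  have "(\<Sum>l<(N + Suc p) * m. (h l)\<^sup>2) = (\<Sum>q<N + p. B q) + B (N + p)"
    unfolding blocks by simp
  also have "\<dots> \<le> (1 + real N * K\<^sup>2) * (\<Sum>l<(N + p) * m. (h l)\<^sup>2)"
    using step unfolding blocks by (simp add: algebra_simps)
  also have "\<dots> \<le> (1 + real N * K\<^sup>2) * ((1 + real N * K\<^sup>2) ^ p * (\<Sum>l<N * m. (h l)\<^sup>2))"
    by (intro mult_left_mono Suc) auto
  finally show ?case by (simp add: algebra_simps)
qed simp

text \<open>The \<open>c q\<close> are the lower coefficients of the monic product of the factors
  \<open>z^2 - 2 cos (\<psi> i) z + 1\<close>, whose roots are \<open>cis (\<psi> i)\<close> and its
  conjugate. The coefficients of one factor have absolute sum at most 4, hence the bound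
  \<open>4 ^ L\<close>, which does not depend on how close the frequencies are.\<close>

lemma cos_annihilator:
  fixes \<psi> :: "nat \<Rightarrow> real"
  shows "\<exists>c::nat \<Rightarrow> real. (\<forall>q. \<bar>c q\<bar> \<le> 4 ^ L) \<and>
    (\<forall>i<L. \<forall>\<phi>. cos (\<phi> + real (2 * L) * \<psi> i) = - (\<Sum>q<2 * L. c q * cos (\<phi> + real q * \<psi> i)))"
proof -
  define P :: "nat \<Rightarrow> complex poly"
    where "P L = (\<Prod>i<L. [:1, - 2 * complex_of_real (cos (\<psi> i)), 1:])" for L
  have P_Suc: "Polynomial.coeff (P (Suc L)) q = Polynomial.coeff (P L) q - 2 * complex_of_real (cos (\<psi> L)) * Polynomial.coeff (pCons 0 (P L)) q
      + Polynomial.coeff (pCons 0 (pCons 0 (P L))) q" for L q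
  proof -
    have "P (Suc L) = P L + Polynomial.smult (- 2 * complex_of_real (cos (\<psi> L))) (pCons 0 (P L)) + pCons 0 (pCons 0 (P L))"
      by (simp add: P_def algebra_simps)
    thus ?thesis by (simp only: coeff_add coeff_smult) simp
  qed
  have deg: "Polynomial.degree (P L) = 2 * L" for L
    unfolding P_def by (subst degree_prod_eq_sum_degree) auto
  have lead: "Polynomial.coeff (P L) (2 * L) = 1" for L
    using lead_coeff_prod[of "\<lambda>i. [:1, - 2 * complex_of_real (cos (\<psi> i)), 1:]" "{..<L}"]
    unfolding deg[symmetric] by (simp add: P_def)
  have real: "Polynomial.coeff (P L) q \<in> \<real>" for L q
  proof (induction L arbitrary: q)
    case (Suc L)
    thus ?case unfolding P_Suc by (auto simp: coeff_pCons split: nat.splits)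
  qed (simp add: P_def)
  have bd: "norm (Polynomial.coeff (P L) q) \<le> 4 ^ L" for L q
  proof (induction L arbitrary: q)
    case (Suc L)
    have shift: "norm (Polynomial.coeff (pCons 0 p) q) \<le> 4 ^ L" if "\<And>q. norm (Polynomial.coeff p q) \<le> 4 ^ L"
      for p :: "complex poly" and q
      using that by (cases q) (auto simp: coeff_pCons)
    have "norm (2 * complex_of_real (cos (\<psi> L)) * Polynomial.coeff (pCons 0 (P L)) q) \<le> 2 * 1 * 4 ^ L"
      unfolding norm_mult by (intro mult_mono shift Suc.IH) auto
    hence "norm (Polynomial.coeff (P (Suc L)) q) \<le> 4 ^ L + 2 * 1 * 4 ^ L + 4 ^ L"
      unfolding P_Suc
      by (intro order_trans[OF norm_triangle_ineq] order_trans[OF norm_triangle_ineq4] add_mono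
          shift Suc.IH)
    thus ?case by simp
  qed (simp add: P_def)
  \<comment> \<open>The polynomial vanishes at \<open>cis (\<psi> i)\<close>. Multiplying by
    \<open>cis \<phi>\<close> and taking real parts gives cosines of phase \<open>\<phi>\<close>,
    because the coefficients are real.\<close>
  have ann: "(\<Sum>q\<le>2 * L. Re (Polynomial.coeff (P L) q) * cos (\<phi> + real q * \<psi> i)) = 0" if "i < L" for i \<phi>
  proof -
    have "poly [:1, - 2 * complex_of_real (cos (\<psi> i)), 1:] (cis (\<psi> i)) = 0"
      using sin_cos_squared_add[of "\<psi> i"]
      by (simp add: complex_eq_iff algebra_simps power2_eq_square)
    hence "poly (P L) (cis (\<psi> i)) = 0"
      using that unfolding P_def poly_prod by (intro prod_zero) auto
    hence "0 = Re (cis \<phi> * poly (P L) (cis (\<psi> i)))" by simp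
    also have "\<dots> = (\<Sum>q\<le>2 * L. Re (Polynomial.coeff (P L) q) * cos (\<phi> + real q * \<psi> i))"
      unfolding poly_altdef deg sum_distrib_left Re_sum
    proof (intro sum.cong refl)
      fix q
      show "Re (cis \<phi> * (Polynomial.coeff (P L) q * cis (\<psi> i) ^ q)) =
          Re (Polynomial.coeff (P L) q) * cos (\<phi> + real q * \<psi> i)"
        using real[of L q] 
        by (auto elim!: Reals_cases simp: Complex.DeMoivre cos_add algebra_simps)
    qed
    finally show ?thesis by simp
  qed
  show ?thesis
  proof (intro exI[of _ "\<lambda>q. Re (Polynomial.coeff (P L) q)"] conjI allI impI)
    show "\<bar>Re (Polynomial.coeff (P L) q)\<bar> \<le> 4 ^ L" for q
      using bd[of L q] abs_Re_le_cmod order_trans by blast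
    fix i \<phi> assume "i < L"
    from ann[OF this, of \<phi>] lead[of L]
    show "cos (\<phi> + real (2 * L) * \<psi> i) = - (\<Sum>q<2 * L. Re (Polynomial.coeff (P L) q) * cos (\<phi> + real q * \<psi> i))"
      by (simp add: lessThan_Suc_atMost[symmetric])
  qed
qed

text \<open>
  The exponential sum is sampled backwards, \<open>h l = F (n - l)\<close>, so that the known values come first,
  and the recurrence has step \<open>m \<approx> n / (4 k)\<close>, so that boundedly many blocks suffice.
\<close>

lemma reflected_energy_bound:
  fixes k n :: nat and x y \<alpha> \<beta> :: "nat \<Rightarrow> real" and F :: "real \<Rightarrow> real"
  defines "F \<equiv> \<lambda>t. (\<Sum>i<k. \<alpha> i * cos (t * x i)) + (\<Sum>i<k. \<beta> i * sin (t * y i))"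
  assumes k: "0 < k" "4 * k \<le> n + 1"
  shows "(\<Sum>l\<le>n. (F (- real l))\<^sup>2) \<le>
    (1 + real (4 * k) * (4 ^ (2 * k))\<^sup>2) ^ (12 * k) * (\<Sum>l\<le>n. (F (real l))\<^sup>2)"
proof -
  define N where "N = 4 * k"
  \<comment> \<open>The first \<open>N\<close> blocks fit into the \<open>n + 1\<close> known
    samples. As \<open>m \<ge> 1\<close>, also \<open>n + 1 < N m + N \<le> 2 N m\<close>, so
    \<open>4 N\<close> blocks cover the indices up to \<open>2 n\<close>; the
    \<open>3 N = 12 k\<close> new ones give the exponent.\<close>
  define m where "m = (n + 1) div N"
  have Nm: "N * m \<le> n + 1"
    by (simp add: m_def)
  have "1 \<le> m"
    using k by (simp add: m_def N_def Suc_le_eq div_greater_zero_iff)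
  moreover have "n + 1 < N * m + N"
    unfolding m_def using k dividend_less_times_div[of N "n + 1"] by (simp add: N_def)
  ultimately have N4: "2 * n < 4 * N * m"
    using mult_le_mono2[of 1 m N] by linarith
  \<comment> \<open>These are the phase increments over one block, first for the \<open>k\<close>
    cosines, then for the \<open>k\<close> sines. With \<open>2 k\<close> frequencies the recurrence
    has \<open>N = 4 k\<close> terms.\<close>
  define \<psi> where "\<psi> i = real m * (if i < k then x i else y (i - k))" for i
  obtain c :: "nat \<Rightarrow> real" where c: "\<And>q. \<bar>c q\<bar> \<le> 4 ^ (2 * k)"
    and ann: "\<And>i \<phi>. i < 2 * k \<Longrightarrow>
      cos (\<phi> + real N * \<psi> i) = - (\<Sum>q<N. c q * cos (\<phi> + real q * \<psi> i))"
    using cos_annihilator[of "2 * k" \<psi>] by (auto simp: N_def)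
  define h where "h l = F (real n - real l)" for l :: nat
  have cos_h: "cos ((real n - real (l + q * m)) * x i) = cos ((real l - real n) * x i + real q * \<psi> i)"
    if "i < k" for l q i
  proof -
    have "(real n - real (l + q * m)) * x i = - ((real l - real n) * x i + real q * \<psi> i)"
      using that by (simp add: \<psi>_def algebra_simps)
    thus ?thesis by (simp only: cos_minus)
  qed
  \<comment> \<open>A sine is a cosine with phase shifted by \<open>pi / 2\<close>, so the free
    phase \<open>\<phi>\<close> of the annihilator treats both kinds alike.\<close>
  have sin_h: "sin ((real n - real (l + q * m)) * y i) =
      cos ((real l - real n) * y i + pi / 2 + real q * \<psi> (k + i))" for l q i
  proof -
    have "(real l - real n) * y i + pi / 2 + real q * \<psi> (k + i) =
        pi / 2 - (real n - real (l + q * m)) * y i"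
      by (simp add: \<psi>_def algebra_simps)
    thus ?thesis by (simp only: cos_sin_eq) simp
  qed
  have rec: "h (l + N * m) = - (\<Sum>q<N. c q * h (l + q * m))" for l
  proof -
    have h: "h (l + q * m) = (\<Sum>i<k. \<alpha> i * cos ((real l - real n) * x i + real q * \<psi> i)) +
        (\<Sum>i<k. \<beta> i * cos ((real l - real n) * y i + pi / 2 + real q * \<psi> (k + i)))" for q
      using cos_h sin_h by (simp add: h_def F_def)
    have "(\<Sum>q<N. c q * h (l + q * m)) =
        (\<Sum>i<k. \<alpha> i * (\<Sum>q<N. c q * cos ((real l - real n) * x i + real q * \<psi> i))) +
        (\<Sum>i<k. \<beta> i * (\<Sum>q<N. c q * cos ((real l - real n) * y i + pi / 2 + real q * \<psi> (k + i))))"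
      unfolding h distrib_left sum.distrib sum_distrib_left
      by (simp add: sum.swap[of _ "{..<k}"] mult.left_commute)
    thus ?thesis
      unfolding h by (simp add: ann sum_negf)
  qed
  have ivl: "(\<Sum>l<4 * N * m. (h l)\<^sup>2) \<le>
      (1 + real N * (4 ^ (2 * k))\<^sup>2) ^ (3 * N) * (\<Sum>l<N * m. (h l)\<^sup>2)"
    using block_extension[of h N m c "4 ^ (2 * k)" "3 * N", OF rec c] by simp
  \<comment> \<open>The samples of \<open>h\<close> at \<open>n, \<dots>, 2 n\<close> are those of
    \<open>F\<close> at \<open>0, \<dots>, -n\<close>.\<close>
  have "(\<Sum>l\<le>n. (F (- real l))\<^sup>2) = (\<Sum>l\<le>n. (h (l + n))\<^sup>2)"
    by (simp add: h_def)
  also have "\<dots> = (\<Sum>l\<in>{n..n + n}. (h l)\<^sup>2)"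
    using sum.shift_bounds_cl_nat_ivl[of "\<lambda>l. (h l)\<^sup>2" 0 n n] by (simp add: atMost_atLeast0)
  also have "\<dots> \<le> (\<Sum>l<4 * N * m. (h l)\<^sup>2)"
    using N4 by (intro sum_mono2) auto
  also note ivl
  also have "(\<Sum>l<N * m. (h l)\<^sup>2) \<le> (\<Sum>l\<le>n. (h l)\<^sup>2)"
    using Nm by (intro sum_mono2) auto
  also have "\<dots> = (\<Sum>l\<le>n. (F (real l))\<^sup>2)"
    by (rule sum.reindex_bij_witness[of _ "\<lambda>l. n - l" "\<lambda>l. n - l"]) (auto simp: h_def of_nat_diff)
  finally show ?thesis
    by (simp add: N_def mult_left_mono)
qed

text \<open>The sine sum is the odd part of the full sum, so its energy is at most that of the full
  sum on both half-lines, and \<open>reflected_energy_bound\<close> controls the negative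
  one.\<close>

lemma sine_part_bound:
  "\<exists>C>0. \<forall>n x y \<alpha> \<beta>. 2 * k \<le> n \<longrightarrow> k \<le> 1 \<or> 4 * k \<le> n + 1 \<longrightarrow>
     L2_set (\<lambda>l. \<Sum>i<k. \<beta> i * sin (real l * y i)) {..n} \<le>
     C * L2_set (\<lambda>l. (\<Sum>i<k. \<alpha> i * cos (real l * x i)) + (\<Sum>i<k. \<beta> i * sin (real l * y i))) {..n}"
proof -
  define D :: real where "D = (1 + real (4 * k) * (4 ^ (2 * k))\<^sup>2) ^ (12 * k)"
  have D: "0 \<le> D" by (simp add: D_def)
  \<comment> \<open>The constant covers \<open>1 + D\<close> from the reflection argument and
    \<open>8 = 2 + 6\<close> from the case \<open>k = 1\<close>, \<open>n = 2\<close>.\<close>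
  have sq: "(\<Sum>l\<le>n. (\<Sum>i<k. \<beta> i * sin (real l * y i))\<^sup>2) \<le> (8 + D) *
      (\<Sum>l\<le>n. ((\<Sum>i<k. \<alpha> i * cos (real l * x i)) + (\<Sum>i<k. \<beta> i * sin (real l * y i)))\<^sup>2)"
    if n: "2 * k \<le> n" "k \<le> 1 \<or> 4 * k \<le> n + 1" for n and x y \<alpha> \<beta> :: "nat \<Rightarrow> real"
  proof -
    define F where "F t = (\<Sum>i<k. \<alpha> i * cos (t * x i)) + (\<Sum>i<k. \<beta> i * sin (t * y i))" for t
    define E where "E = (\<Sum>l\<le>n. (F (real l))\<^sup>2)"
    have E: "0 \<le> E" by (simp add: E_def sum_nonneg)
    have "(\<Sum>l\<le>n. (\<Sum>i<k. \<beta> i * sin (real l * y i))\<^sup>2) \<le> (8 + D) * E"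
    proof -
      \<comment> \<open>For \<open>k = 1\<close>, \<open>n = 2\<close> is the only value with
        \<open>2 k \<le> n\<close> that violates \<open>4 k \<le> n + 1\<close>.\<close>
      consider "k = 0" | "0 < k" "4 * k \<le> n + 1" | "k = 1" "n = 2"
        using n by linarith
      thus ?thesis
      proof cases
        case 1
        thus ?thesis using D E by simp
      next
        case 2
        have odd: "(\<Sum>i<k. \<beta> i * sin (real l * y i)) = (F (real l) - F (- real l)) / 2" for l
          by (simp add: F_def sum_negf)
        have "((a - b) / 2)\<^sup>2 \<le> a\<^sup>2 + b\<^sup>2" for a b :: real
        proof -
          have "a\<^sup>2 + b\<^sup>2 - ((a - b) / 2)\<^sup>2 = ((a + b)\<^sup>2 + 2 * a\<^sup>2 + 2 * b\<^sup>2) / 4"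
            by (simp add: power2_eq_square field_simps)
          moreover have "0 \<le> ((a + b)\<^sup>2 + 2 * a\<^sup>2 + 2 * b\<^sup>2) / 4"
            by simp
          ultimately show ?thesis by linarith
        qed
        hence "(\<Sum>l\<le>n. (\<Sum>i<k. \<beta> i * sin (real l * y i))\<^sup>2) \<le> E + (\<Sum>l\<le>n. (F (- real l))\<^sup>2)"
          unfolding odd E_def sum.distrib[symmetric] by (rule sum_mono)
        also have "\<dots> \<le> E + D * E"
          using reflected_energy_bound[OF 2, of \<alpha> x \<beta> y] by (simp add: D_def E_def F_def)
        also have "\<dots> \<le> (8 + D) * E"
          using E by (simp add: algebra_simps)
        finally show ?thesis .
      next
        case 3
        define a b where "a = \<alpha> 0" and "b l = \<beta> 0 * sin (real l * y 0)" for l :: nat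
        have F: "F (real l) = a * cos (real l * x 0) + b l" for l
          using 3 by (simp add: F_def a_def b_def)
        have "(b l)\<^sup>2 \<le> 2 * (F (real l))\<^sup>2 + 2 * a\<^sup>2" for l
        proof -
          have "(b l)\<^sup>2 \<le> 2 * (F (real l))\<^sup>2 + 2 * (a * cos (real l * x 0))\<^sup>2"
            using zero_le_power2[of "F (real l) + a * cos (real l * x 0)"]
            unfolding F by (simp add: power2_eq_square algebra_simps)
          also have "(a * cos (real l * x 0))\<^sup>2 \<le> a\<^sup>2"
            by (simp add: power_mult_distrib mult_left_le abs_square_le_1)
          finally show ?thesis by simp
        qed
        hence "(\<Sum>l\<le>n. (b l)\<^sup>2) \<le> (\<Sum>l\<le>n. 2 * (F (real l))\<^sup>2 + 2 * a\<^sup>2)"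
          by (intro sum_mono)
        also have "\<dots> = 2 * E + 6 * a\<^sup>2"
          using 3 by (simp add: sum.distrib E_def sum_distrib_left)
        \<comment> \<open>At \<open>l = 0\<close> the sine vanishes and the cosine is 1, so
          \<open>F 0 = a\<close>.\<close>
        also have "a\<^sup>2 \<le> E"
          using member_le_sum[of 0 "{..n}" "\<lambda>l. (F (real l))\<^sup>2"] F[of 0] by (simp add: E_def b_def)
        finally show ?thesis
          using 3 D E by (simp add: b_def algebra_simps) (smt (verit) mult_nonneg_nonneg)
      qed
    qed
    thus ?thesis by (simp add: E_def F_def)
  qed
  show ?thesis
  proof (intro exI[of _ "sqrt (8 + D)"] conjI allI impI)
    show "0 < sqrt (8 + D)" using D by simp
  next
    fix n and x y \<alpha> \<beta> :: "nat \<Rightarrow> real" assume n: "2 * k \<le> n" "k \<le> 1 \<or> 4 * k \<le> n + 1"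
    show "L2_set (\<lambda>l. \<Sum>i<k. \<beta> i * sin (real l * y i)) {..n} \<le> sqrt (8 + D) *
      L2_set (\<lambda>l. (\<Sum>i<k. \<alpha> i * cos (real l * x i)) + (\<Sum>i<k. \<beta> i * sin (real l * y i))) {..n}"
      unfolding L2_set_def real_sqrt_mult[symmetric] by (intro real_sqrt_le_mono sq n)
  qed
qed

section \<open>Residuals of the derivative vectors\<close>

text \<open>A duality argument: \<open>r\<close> is orthogonal to \<open>u\<close> and all
  \<open>v i\<close>, so pairing it with the image of \<open>u - (\<Sum>i\<in>I. c i * v i)\<close>
  leaves only minus its product with \<open>b\<close>, that is minus its squared norm. Thus
  \<open>\<kappa>\<close>, \<open>A\<close> and \<open>B\<close> drop out, however large they are
  when points nearly coincide.\<close>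

lemma residual_le_duhamel:
  assumes u: "\<And>j. duhamel x u j = \<kappa> * u j - b j"
    and v: "\<And>i j. i \<in> I \<Longrightarrow> duhamel x (v i) j = A i * v i j + B i * u j"
    and ru: "(\<Sum>l\<le>n. r l * u l) = 0"
    and rv: "\<And>i. i \<in> I \<Longrightarrow> (\<Sum>l\<le>n. r l * v i l) = 0"
    and rr: "(\<Sum>l\<le>n. (r l)\<^sup>2) = (\<Sum>l\<le>n. r l * b l)"
  shows "L2_set r {..n} \<le> 2 * (real n + 1) * L2_set (\<lambda>l. u l - (\<Sum>i\<in>I. c i * v i l)) {..n}"
proof -
  let ?q = "\<lambda>l. u l - (\<Sum>i\<in>I. c i * v i l)"
  have D: "duhamel x ?q j = \<kappa> * u j - b j - (\<Sum>i\<in>I. c i * (A i * v i j + B i * u j))" for j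
    by (simp add: duhamel_diff duhamel_sum u v)
  have "(\<Sum>l\<le>n. r l * duhamel x ?q l) =
      \<kappa> * (\<Sum>l\<le>n. r l * u l) - (\<Sum>l\<le>n. r l * b l) -
      (\<Sum>i\<in>I. c i * (A i * (\<Sum>l\<le>n. r l * v i l) + B i * (\<Sum>l\<le>n. r l * u l)))"
  proof -
    have "(\<Sum>l\<le>n. r l * (\<Sum>i\<in>I. c i * (A i * v i l + B i * u l))) =
        (\<Sum>i\<in>I. c i * (A i * (\<Sum>l\<le>n. r l * v i l) + B i * (\<Sum>l\<le>n. r l * u l)))"
      unfolding sum_distrib_left
      by (subst sum.swap) (simp add: sum_distrib_left sum.distrib algebra_simps)
    thus ?thesis
      unfolding D by (simp add: right_diff_distrib sum_subtractf sum_distrib_left mult.left_commute)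
  qed
  hence "(\<Sum>l\<le>n. (r l)\<^sup>2) = - (\<Sum>l\<le>n. r l * duhamel x ?q l)"
    by (simp add: ru rv rr)
  also have "\<dots> \<le> (\<Sum>l\<le>n. \<bar>r l\<bar> * \<bar>duhamel x ?q l\<bar>)"
    using sum_abs[of "\<lambda>l. r l * duhamel x ?q l" "{..n}"] by (simp add: abs_mult)
  also have "\<dots> \<le> L2_set r {..n} * L2_set (duhamel x ?q) {..n}"
    by (rule L2_set_mult_ineq)
  finally have "L2_set r {..n} * L2_set r {..n} \<le> L2_set r {..n} * L2_set (duhamel x ?q) {..n}"
    by (simp add: L2_set_def sum_nonneg)
  \<comment> \<open>The norm of \<open>r\<close> is cancelled; if it is 0, the bound is
    immediate.\<close>
  hence "L2_set r {..n} \<le> L2_set (duhamel x ?q) {..n}"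
    by (cases "L2_set r {..n} = 0") (simp_all add: less_le)
  also note L2_set_duhamel_le
  finally show ?thesis .
qed

text \<open>Cosine is injective on \<open>[0, pi]\<close>, so \<open>duhamel_cos\<close> may be
  divided by \<open>cos (t i) - cos x\<close>; this gives \<open>A\<close> and
  \<open>B\<close>.\<close>

lemma cos_residual_bound:
  assumes x: "0 < x" "x < pi" and t: "\<And>i. i \<in> I \<Longrightarrow> 0 < t i \<and> t i < pi \<and> t i \<noteq> x"
    and "(\<Sum>l\<le>n. r l * cos (real l * x)) = 0"
    and "\<And>i. i \<in> I \<Longrightarrow> (\<Sum>l\<le>n. r l * cos (real l * t i)) = 0"
    and "(\<Sum>l\<le>n. (r l)\<^sup>2) = (\<Sum>l\<le>n. r l * - (real l * sin (real l * x)))"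
  shows "L2_set r {..n} \<le>
    2 * (real n + 1) * L2_set (\<lambda>l. cos (real l * x) - (\<Sum>i\<in>I. c i * cos (real l * t i))) {..n}"
proof (rule residual_le_duhamel[where x = x and \<kappa> = 0 and b = "\<lambda>l. - (real l * sin (real l * x))"
      and A = "\<lambda>i. sin x / (cos (t i) - cos x)" and B = "\<lambda>i. - sin x / (cos (t i) - cos x)"])
  fix i j assume "i \<in> I"
  hence "cos (t i) \<noteq> cos x"
    using t x cos_inj_pi[of "t i" x] by force
  hence "duhamel x (\<lambda>l. cos (real l * t i)) j =
      sin x * (cos (real j * t i) - cos (real j * x)) / (cos (t i) - cos x)"
    using duhamel_cos[of "t i" x j] by (simp add: eq_divide_eq mult.commute)
  thus "duhamel x (\<lambda>l. cos (real l * t i)) j =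
      sin x / (cos (t i) - cos x) * cos (real j * t i) + - sin x / (cos (t i) - cos x) * cos (real j * x)"
    by (simp add: right_diff_distrib diff_divide_distrib)
qed (use assms in \<open>auto simp: duhamel_cos_same\<close>)

text \<open>As for cosines, except that dividing \<open>duhamel_sin_same\<close> by
  \<open>sin x\<close> leaves \<open>\<kappa> = cos x / sin x\<close>.\<close>

lemma sin_residual_bound:
  assumes x: "0 < x" "x < pi" and t: "\<And>i. i \<in> I \<Longrightarrow> 0 < t i \<and> t i < pi \<and> t i \<noteq> x"
    and "(\<Sum>l\<le>n. r l * sin (real l * x)) = 0"
    and "\<And>i. i \<in> I \<Longrightarrow> (\<Sum>l\<le>n. r l * sin (real l * t i)) = 0"
    and "(\<Sum>l\<le>n. (r l)\<^sup>2) = (\<Sum>l\<le>n. r l * (real l * cos (real l * x)))"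
  shows "L2_set r {..n} \<le>
    2 * (real n + 1) * L2_set (\<lambda>l. sin (real l * x) - (\<Sum>i\<in>I. c i * sin (real l * t i))) {..n}"
proof (rule residual_le_duhamel[where x = x and \<kappa> = "cos x / sin x"
      and b = "\<lambda>l. real l * cos (real l * x)"
      and A = "\<lambda>i. sin x / (cos (t i) - cos x)" and B = "\<lambda>i. - sin (t i) / (cos (t i) - cos x)"])
  fix i j assume "i \<in> I"
  hence "cos (t i) \<noteq> cos x"
    using t x cos_inj_pi[of "t i" x] by force
  hence "duhamel x (\<lambda>l. sin (real l * t i)) j =
      (sin x * sin (real j * t i) - sin (t i) * sin (real j * x)) / (cos (t i) - cos x)"
    using duhamel_sin[of "t i" x j] by (simp add: eq_divide_eq mult.commute)
  thus "duhamel x (\<lambda>l. sin (real l * t i)) j =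
      sin x / (cos (t i) - cos x) * sin (real j * t i) + - sin (t i) / (cos (t i) - cos x) * sin (real j * x)"
    by (simp add: diff_divide_distrib)
next
  fix j
  have "sin x \<noteq> 0" using sin_gt_zero[OF x] by simp
  thus "duhamel x (\<lambda>l. sin (real l * x)) j = cos x / sin x * sin (real j * x) - real j * cos (real j * x)"
    using duhamel_sin_same[of x j] by (simp add: field_simps)
qed (use assms in auto)

section \<open>Gram determinants\<close>

text \<open>
  If \<open>gram_schmidt_vec n a j\<close> vanishes on \<open>{..n}\<close>, its coefficient is \<open>0 / 0 = 0\<close>, so that linearly
  dependent families need no special treatment.
\<close>

fun gram_schmidt_vec :: "nat \<Rightarrow> (nat \<Rightarrow> nat \<Rightarrow> real) \<Rightarrow> nat \<Rightarrow> nat \<Rightarrow> real" where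
  "gram_schmidt_vec n a i = (\<lambda>l. a i l -
     (\<Sum>j<i. (\<Sum>p\<le>n. a i p * gram_schmidt_vec n a j p) / (\<Sum>p\<le>n. (gram_schmidt_vec n a j p)\<^sup>2) *
        gram_schmidt_vec n a j l))"

declare gram_schmidt_vec.simps [simp del]

lemma gram_schmidt_vec_orthogonal:
  "j < i \<Longrightarrow> (\<Sum>l\<le>n. gram_schmidt_vec n a i l * gram_schmidt_vec n a j l) = 0"
proof (induction i arbitrary: j rule: less_induct)
  case (less i)
  let ?q = "gram_schmidt_vec n a"
  define \<mu> where "\<mu> s = (\<Sum>p\<le>n. a i p * ?q s p) / (\<Sum>p\<le>n. (?q s p)\<^sup>2)" for s
  have orth: "(\<Sum>l\<le>n. ?q s l * ?q j l) = 0" if "s < i" "s \<noteq> j" for s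
  proof (cases "s < j")
    case True
    thus ?thesis using less.IH[of j s] less.prems by (simp add: mult.commute)
  next
    case False
    thus ?thesis using less.IH[of s j] that by simp
  qed
  have "(\<Sum>l\<le>n. ?q i l * ?q j l) =
      (\<Sum>l\<le>n. a i l * ?q j l) - (\<Sum>s<i. \<mu> s * (\<Sum>l\<le>n. ?q s l * ?q j l))"
    unfolding gram_schmidt_vec.simps[of n a i] \<mu>_def[symmetric] left_diff_distrib sum_subtractf
      sum_distrib_left sum_distrib_right
    by (subst (2) sum.swap) (simp add: mult.assoc)
  also have "(\<Sum>s<i. \<mu> s * (\<Sum>l\<le>n. ?q s l * ?q j l)) = \<mu> j * (\<Sum>l\<le>n. (?q j l)\<^sup>2)"
    using less.prems orth by (subst sum.remove[of _ j]) (auto simp: power2_eq_square)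
  also have "\<dots> = (\<Sum>l\<le>n. a i l * ?q j l)"
  \<comment> \<open>If \<open>?q j\<close> vanishes, both sides are 0; otherwise its squared norm
    cancels.\<close>
  proof (cases "(\<Sum>l\<le>n. (?q j l)\<^sup>2) = 0")
    case True
    hence "\<forall>l\<in>{..n}. ?q j l = 0"
      by (subst (asm) sum_nonneg_eq_0_iff) auto
    thus ?thesis by simp
  qed (simp add: \<mu>_def)
  finally show ?case by simp
qed

text \<open>The residual bounds need this form: \<open>a i\<close> minus a combination of the
  earlier vectors themselves.\<close>

lemma gram_schmidt_vec_span:
  "\<exists>c. \<forall>l. gram_schmidt_vec n a i l = a i l - (\<Sum>j<i. c j * a j l)"
proof (induction i rule: less_induct)
  case (less i)
  let ?q = "gram_schmidt_vec n a"
  define \<mu> where "\<mu> s = (\<Sum>p\<le>n. a i p * ?q s p) / (\<Sum>p\<le>n. (?q s p)\<^sup>2)" for s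
  have "\<forall>s. \<exists>d. s < i \<longrightarrow> (\<forall>l. ?q s l = a s l - (\<Sum>j<s. d j * a j l))"
    using less by blast
  then obtain d where d: "\<And>s l. s < i \<Longrightarrow> ?q s l = a s l - (\<Sum>j<s. d s j * a j l)"
    by metis
  \<comment> \<open>Row \<open>s\<close> of \<open>e\<close> holds the coefficients of
    \<open>?q s\<close> in the original family.\<close>
  define e where "e s j = (if j = s then 1 else if j < s then - d s j else 0)" for s j :: nat
  have e: "?q s l = (\<Sum>j<i. e s j * a j l)" if "s < i" for s l
  proof -
    have "(\<Sum>j<i. e s j * a j l) = (\<Sum>j<Suc s. e s j * a j l)"
      using that by (intro sum.mono_neutral_right) (auto simp: e_def)
    thus ?thesis
      using d[OF that] by (simp add: e_def sum_negf)
  qed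
  have "?q i l = a i l - (\<Sum>j<i. (\<Sum>s<i. \<mu> s * e s j) * a j l)" for l
  proof -
    have "?q i l = a i l - (\<Sum>s<i. \<mu> s * ?q s l)"
      by (subst gram_schmidt_vec.simps) (simp add: \<mu>_def)
    also have "(\<Sum>s<i. \<mu> s * ?q s l) = (\<Sum>s<i. \<mu> s * (\<Sum>j<i. e s j * a j l))"
      by (intro sum.cong) (auto simp: e)
    also have "(\<Sum>s<i. \<mu> s * (\<Sum>j<i. e s j * a j l)) = (\<Sum>j<i. (\<Sum>s<i. \<mu> s * e s j) * a j l)"
      unfolding sum_distrib_left sum_distrib_right by (subst sum.swap) (simp add: mult.assoc)
    finally show ?thesis .
  qed
  thus ?case by (intro exI[of _ "\<lambda>j. \<Sum>s<i. \<mu> s * e s j"]) simp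
qed

text \<open>Gram-Schmidt writes \<open>a\<close> as a unit lower triangular matrix \<open>L\<close>
  times an orthogonal family, so the Gram matrix is \<open>L diag(d) L^T\<close>. In the proof
  \<open>D\<close> stands for \<open>L diag(d)\<close>.\<close>

lemma det_gram_eq_prod:
  "Determinant.det (Matrix.mat m m (\<lambda>(i, j). \<Sum>l\<le>n. a i l * a j l)) =
     (\<Prod>i<m. \<Sum>l\<le>n. (gram_schmidt_vec n a i l)\<^sup>2)"
proof -
  let ?q = "gram_schmidt_vec n a"
  define d where "d s = (\<Sum>p\<le>n. (?q s p)\<^sup>2)" for s
  define \<mu> where "\<mu> i j = (if j < i then (\<Sum>p\<le>n. a i p * ?q j p) / d j else if j = i then 1 else 0)"
    for i j
  define L D where "L = Matrix.mat m m (\<lambda>(i, j). \<mu> i j)"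
    and "D = Matrix.mat m m (\<lambda>(i, j). \<mu> i j * d j)"
  have a: "a i l = (\<Sum>j<m. \<mu> i j * ?q j l)" if "i < m" for i l
  proof -
    have "(\<Sum>j<m. \<mu> i j * ?q j l) = (\<Sum>j<Suc i. \<mu> i j * ?q j l)"
      using that by (intro sum.mono_neutral_right) (auto simp: \<mu>_def)
    thus ?thesis
      by (simp add: \<mu>_def) (subst gram_schmidt_vec.simps, simp add: d_def)
  qed
  have orth: "(\<Sum>l\<le>n. ?q s l * ?q t l) = (if s = t then d s else 0)" for s t
    using gram_schmidt_vec_orthogonal[of s t n a] gram_schmidt_vec_orthogonal[of t s n a]
    by (cases s t rule: linorder_cases) (auto simp: d_def power2_eq_square mult.commute)
  have entry: "(\<Sum>l\<le>n. a i l * a j l) = (\<Sum>s<m. \<mu> i s * d s * \<mu> j s)" if "i < m" "j < m" for i j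
  proof -
    have "(\<Sum>l\<le>n. a i l * a j l) = (\<Sum>l\<le>n. \<Sum>s<m. \<Sum>t<m. \<mu> i s * \<mu> j t * (?q s l * ?q t l))"
      unfolding a[OF that(1)] a[OF that(2)] sum_product by (simp add: mult_ac)
    also have "\<dots> = (\<Sum>s<m. \<Sum>l\<le>n. \<Sum>t<m. \<mu> i s * \<mu> j t * (?q s l * ?q t l))"
      by (rule sum.swap)
    also have "\<dots> = (\<Sum>s<m. \<Sum>t<m. \<Sum>l\<le>n. \<mu> i s * \<mu> j t * (?q s l * ?q t l))"
      by (intro sum.cong refl sum.swap)
    also have "\<dots> = (\<Sum>s<m. \<mu> i s * d s * \<mu> j s)"
      unfolding sum_distrib_left[symmetric] orth
      by (intro sum.cong refl) (simp add: if_distrib[of "\<lambda>z. _ * z"] sum.delta' mult_ac cong: if_cong)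
    finally show ?thesis .
  qed
  have "Matrix.mat m m (\<lambda>(i, j). \<Sum>l\<le>n. a i l * a j l) = D * transpose_mat L"
    by (rule eq_matI) (auto simp: D_def L_def scalar_prod_def entry lessThan_atLeast0)
  hence "Determinant.det (Matrix.mat m m (\<lambda>(i, j). \<Sum>l\<le>n. a i l * a j l)) =
      Determinant.det D * Determinant.det L"
    by (simp add: det_mult[of _ m] det_transpose[of _ m] D_def L_def)
  also have "Determinant.det L = 1"
    by (subst det_lower_triangular[of m]) (auto simp: L_def \<mu>_def prod_list_diag_prod)
  also have "Determinant.det D = (\<Prod>i<m. d i)"
    by (subst det_lower_triangular[of m])
       (auto simp: D_def \<mu>_def prod_list_diag_prod lessThan_atLeast0 intro!: prod.cong)
  finally show ?thesis by (simp add: d_def)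
qed

text \<open>Padding the coefficient vectors with zeros to length \<open>m\<close> makes the Gram
  matrix a product \<open>A A^T\<close> of square matrices, so \<open>A\<close> is injective, while
  it sends the padded \<open>r\<close> to 0.\<close>

lemma orthogonal_eq_0_if_gram_det_nonzero:
  assumes m: "n < m"
    and det: "Determinant.det (Matrix.mat m m (\<lambda>(i, j). \<Sum>l\<le>n. a i l * a j l)) \<noteq> (0::real)"
    and orth: "\<And>i. i < m \<Longrightarrow> (\<Sum>l\<le>n. r l * a i l) = 0" and l: "l \<le> n"
  shows "r l = 0"
proof -
  define A where "A = Matrix.mat m m (\<lambda>(i, l). if l \<le> n then a i l else 0)"
  define v where "v = Matrix.vec m (\<lambda>l. if l \<le> n then r l else 0)"
  have trunc: "(\<Sum>l = 0..<m. (if l \<le> n then f l else 0)) = (\<Sum>l\<le>n. f l)" for f :: "nat \<Rightarrow> real"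
    using m by (intro sum.mono_neutral_cong_right) auto
  have "Matrix.mat m m (\<lambda>(i, j). \<Sum>l\<le>n. a i l * a j l) = A * transpose_mat A"
    by (rule eq_matI) (auto simp: A_def scalar_prod_def trunc[symmetric] intro!: sum.cong)
  with det have "Determinant.det A \<noteq> 0"
    by (auto simp: det_mult[of _ m] A_def)
  moreover have "A *\<^sub>v v = 0\<^sub>v m"
  proof (rule eq_vecI)
    fix i assume "i < dim_vec (0\<^sub>v m)"
    hence "i < m" by simp
    have "(A *\<^sub>v v) $ i = (\<Sum>l = 0..<m. (if l \<le> n then r l * a i l else 0))"
      using \<open>i < m\<close> by (auto simp: A_def v_def scalar_prod_def intro!: sum.cong)
    thus "(A *\<^sub>v v) $ i = 0\<^sub>v m $ i"
      using \<open>i < m\<close> orth by (simp add: trunc)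
  qed (simp add: A_def)
  moreover have "A \<in> carrier_mat m m" "v \<in> carrier_vec m"
    by (simp_all add: A_def v_def)
  ultimately have "v = 0\<^sub>v m"
    using det_0_iff_vec_prod_zero_field by blast
  hence "v $ l = 0" using l m by simp
  thus ?thesis using l m by (simp add: v_def)
qed

section \<open>Products of Gaussian linear forms\<close>

lemma iid_std_gaussian_mean:
  assumes "iid_std_gaussian M J \<epsilon>" "i \<in> J"
  shows "integrable M (\<epsilon> i)" "(LINT \<omega>|M. \<epsilon> i \<omega>) = 0"
proof -
  interpret prob_space M using assms by (simp add: iid_std_gaussian_def)
  have D: "distributed M lborel (\<epsilon> i) std_normal_density"
    using assms by (auto simp: iid_std_gaussian_def)
  show "integrable M (\<epsilon> i)"
    using distributed_integrable[OF D, of "\<lambda>x. x"] integrable_std_normal_moment[of 1] by simp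
  show "(LINT \<omega>|M. \<epsilon> i \<omega>) = 0"
    using standard_normal_distributed_expectation[OF D] .
qed

lemma iid_std_gaussian_second_moment:
  assumes "iid_std_gaussian M J \<epsilon>" "i \<in> J" "j \<in> J"
  shows "integrable M (\<lambda>\<omega>. \<epsilon> i \<omega> * \<epsilon> j \<omega>)"
    and "(LINT \<omega>|M. \<epsilon> i \<omega> * \<epsilon> j \<omega>) = (if i = j then 1 else 0)"
proof -
  interpret prob_space M using assms by (simp add: iid_std_gaussian_def)
  have indep: "indep_vars (\<lambda>_. borel) \<epsilon> J" and D: "distributed M lborel (\<epsilon> i) std_normal_density"
    using assms by (auto simp: iid_std_gaussian_def)
  have "integrable M (\<lambda>\<omega>. \<epsilon> i \<omega> * \<epsilon> j \<omega>) \<and>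
    (LINT \<omega>|M. \<epsilon> i \<omega> * \<epsilon> j \<omega>) = (if i = j then 1 else 0)"
  proof (cases "i = j")
    case True
    thus ?thesis
      using distributed_integrable[OF D, of "\<lambda>x. x ^ 2"] integrable_std_normal_moment[of 2]
        distributed_integral[OF D, of "\<lambda>x. x ^ 2"] integral_std_normal_moment_even[of 1]
      by (simp add: power2_eq_square)
  next
    case False
    have "indep_vars (\<lambda>_. borel) \<epsilon> {i, j}"
      using indep_vars_subset[OF indep, of "{i, j}"] assms by simp
    moreover have "\<And>l. l \<in> {i, j} \<Longrightarrow> integrable M (\<epsilon> l)"
      using iid_std_gaussian_mean(1) assms by blast
    ultimately have "integrable M (\<lambda>\<omega>. \<Prod>l\<in>{i, j}. \<epsilon> l \<omega>)"
      and "(LINT \<omega>|M. (\<Prod>l\<in>{i, j}. \<epsilon> l \<omega>)) = (\<Prod>l\<in>{i, j}. LINT \<omega>|M. \<epsilon> l \<omega>)"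
      by (intro indep_vars_lebesgue_integral indep_vars_integrable; simp)+
    thus ?thesis
      using False iid_std_gaussian_mean(2)[OF assms(1,2)] by simp
  qed
  thus "integrable M (\<lambda>\<omega>. \<epsilon> i \<omega> * \<epsilon> j \<omega>)"
    and "(LINT \<omega>|M. \<epsilon> i \<omega> * \<epsilon> j \<omega>) = (if i = j then 1 else 0)" by auto
qed

text \<open>This identifies covariance matrices with Gram matrices of the coefficient
  vectors.\<close>

lemma covariance_linear_combination:
  assumes "iid_std_gaussian M {0..n} \<epsilon>"
  shows "covariance M (\<lambda>\<omega>. \<Sum>l\<le>n. \<epsilon> l \<omega> * a l) (\<lambda>\<omega>. \<Sum>l\<le>n. \<epsilon> l \<omega> * b l) = (\<Sum>l\<le>n. a l * b l)"
proof -
  note mean_eps = iid_std_gaussian_mean[OF assms] and mom = iid_std_gaussian_second_moment[OF assms]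
  have mean: "(LINT \<omega>|M. (\<Sum>l\<le>n. \<epsilon> l \<omega> * c l)) = 0" for c :: "nat \<Rightarrow> real"
    by (subst Bochner_Integration.integral_sum) (auto simp: mean_eps)
  have "covariance M (\<lambda>\<omega>. \<Sum>l\<le>n. \<epsilon> l \<omega> * a l) (\<lambda>\<omega>. \<Sum>l\<le>n. \<epsilon> l \<omega> * b l) =
      (LINT \<omega>|M. (\<Sum>l\<le>n. \<Sum>p\<le>n. a l * b p * (\<epsilon> l \<omega> * \<epsilon> p \<omega>)))"
    unfolding covariance_def mean by (simp add: sum_product mult_ac)
  also have "\<dots> = (\<Sum>l\<le>n. LINT \<omega>|M. (\<Sum>p\<le>n. a l * b p * (\<epsilon> l \<omega> * \<epsilon> p \<omega>)))"
    by (intro Bochner_Integration.integral_sum Bochner_Integration.integrable_sum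
        integrable_mult_right mom) auto
  also have "\<dots> = (\<Sum>l\<le>n. \<Sum>p\<le>n. LINT \<omega>|M. a l * b p * (\<epsilon> l \<omega> * \<epsilon> p \<omega>))"
    by (intro sum.cong refl Bochner_Integration.integral_sum integrable_mult_right mom) auto
  also have "\<dots> = (\<Sum>l\<le>n. \<Sum>p\<le>n. a l * b p * (if l = p then 1 else 0))"
    by (simp add: mom)
  also have "\<dots> = (\<Sum>l\<le>n. a l * b l)"
    by (simp add: if_distrib[of "\<lambda>z. _ * z"] sum.delta cong: if_cong)
  finally show ?thesis .
qed

lemma normalized_combination_std_normal:
  assumes "iid_std_gaussian M {0..n} \<epsilon>" and pos: "0 < L2_set r {..n}"
  shows "distributed M lborel (\<lambda>\<omega>. (\<Sum>l\<le>n. \<epsilon> l \<omega> * r l) / L2_set r {..n}) std_normal_density"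
proof -
  interpret prob_space M using assms by (simp add: iid_std_gaussian_def)
  \<comment> \<open>Zero coefficients are dropped because a constant 0 has no normal
    density.\<close>
  define J where "J = {l \<in> {..n}. r l \<noteq> 0}"
  have "J \<noteq> {}"
  proof
    assume "J = {}"
    hence "L2_set r {..n} = 0" by (auto simp: J_def L2_set_eq_0_iff)
    with pos show False by simp
  qed
  have "indep_vars (\<lambda>_. borel) \<epsilon> J"
    using assms(1) by (auto simp: iid_std_gaussian_def J_def intro: indep_vars_subset)
  hence "indep_vars (\<lambda>_. borel) (\<lambda>l \<omega>. \<epsilon> l \<omega> * r l) J"
    by (rule indep_vars_compose2) auto
  moreover have "distributed M lborel (\<lambda>\<omega>. \<epsilon> l \<omega> * r l) (normal_density 0 \<bar>r l\<bar>)" if "l \<in> J" for l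
    using normal_density_affine[of "\<epsilon> l" 0 1 "r l" 0] assms(1) that
    by (simp add: J_def iid_std_gaussian_def mult.commute)
  ultimately have "distributed M lborel (\<lambda>\<omega>. \<Sum>l\<in>J. \<epsilon> l \<omega> * r l)
      (normal_density (\<Sum>l\<in>J. 0) (sqrt (\<Sum>l\<in>J. \<bar>r l\<bar>\<^sup>2)))"
    using \<open>J \<noteq> {}\<close> by (intro sum_indep_normal) (auto simp: J_def)
  moreover have "(\<Sum>l\<in>J. \<epsilon> l \<omega> * r l) = (\<Sum>l\<le>n. \<epsilon> l \<omega> * r l)" for \<omega>
    by (intro sum.mono_neutral_left) (auto simp: J_def)
  moreover have "(\<Sum>l\<in>J. \<bar>r l\<bar>\<^sup>2) = (\<Sum>l\<le>n. (r l)\<^sup>2)"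
    by (subst power2_abs, intro sum.mono_neutral_left) (auto simp: J_def)
  ultimately have "distributed M lborel (\<lambda>\<omega>. \<Sum>l\<le>n. \<epsilon> l \<omega> * r l) (normal_density 0 (L2_set r {..n}))"
    by (simp add: L2_set_def)
  thus ?thesis
    using normal_standard_normal_convert[OF pos, of "\<lambda>\<omega>. \<Sum>l\<le>n. \<epsilon> l \<omega> * r l" 0] by simp
qed

text \<open>The largest factor dominates the others. This reduces a product of dependent variables
  to one-dimensional moments; the summand 1 covers the empty product.\<close>

lemma prod_abs_le_one_plus_sum_power:
  fixes g :: "nat \<Rightarrow> real"
  shows "(\<Prod>i<m. \<bar>g i\<bar>) \<le> 1 + (\<Sum>i<m. \<bar>g i\<bar> ^ m)"
proof (cases "m = 0")
  case False
  hence "(\<lambda>i. \<bar>g i\<bar>) ` {..<m} \<noteq> {}" by auto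
  hence "Max ((\<lambda>i. \<bar>g i\<bar>) ` {..<m}) \<in> (\<lambda>i. \<bar>g i\<bar>) ` {..<m}"
    by (intro Max_in) simp_all
  then obtain s where "s \<in> {..<m}" and max: "Max ((\<lambda>i. \<bar>g i\<bar>) ` {..<m}) = \<bar>g s\<bar>"
    by (rule imageE) simp
  moreover have "\<bar>g i\<bar> \<le> \<bar>g s\<bar>" if "i < m" for i
    unfolding max[symmetric] using that by (intro Max_ge) simp_all
  ultimately have s: "s < m" "\<And>i. i < m \<Longrightarrow> \<bar>g i\<bar> \<le> \<bar>g s\<bar>"
    by simp_all
  have "(\<Prod>i<m. \<bar>g i\<bar>) \<le> (\<Prod>i<m. \<bar>g s\<bar>)"
    using s by (intro prod_mono) auto
  also have "\<dots> \<le> (\<Sum>i<m. \<bar>g i\<bar> ^ m)"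
    using s member_le_sum[of s "{..<m}" "\<lambda>i. \<bar>g i\<bar> ^ m"] by simp
  finally show ?thesis by simp
qed simp

text \<open>After normalisation every form is standard normal, so its \<open>m\<close>-th absolute
  moment is \<open>\<mu>\<close>, and the constant \<open>1 + m \<mu>\<close> works whatever the
  correlations are.\<close>

lemma gaussian_abs_product_bound:
  fixes m :: nat
  shows "\<exists>C>0. \<forall>n (M :: 'a measure) \<epsilon> r. iid_std_gaussian M {0..n} \<epsilon> \<longrightarrow>
     (LINT \<omega>|M. (\<Prod>i<m. \<bar>\<Sum>l\<le>n. \<epsilon> l \<omega> * r i l\<bar>)) \<le> C * (\<Prod>i<m. L2_set (r i) {..n})"
proof -
  define \<mu> where "\<mu> = (LINT x|lborel. std_normal_density x * \<bar>x\<bar> ^ m)"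
  have "0 \<le> \<mu>" unfolding \<mu>_def by (intro integral_nonneg_AE) auto
  show ?thesis
  proof (intro exI[of _ "1 + real m * \<mu>"] conjI allI impI)
    show "0 < 1 + real m * \<mu>" using \<open>0 \<le> \<mu>\<close> by (simp add: add_pos_nonneg)
  next
    fix n and M :: "'a measure" and \<epsilon> and r :: "nat \<Rightarrow> nat \<Rightarrow> real"
    assume iid: "iid_std_gaussian M {0..n} \<epsilon>"
    interpret prob_space M using iid by (simp add: iid_std_gaussian_def)
    define s where "s i = L2_set (r i) {..n}" for i
    define g where "g i \<omega> = (\<Sum>l\<le>n. \<epsilon> l \<omega> * r i l) / s i" for i \<omega>
    show "(LINT \<omega>|M. (\<Prod>i<m. \<bar>\<Sum>l\<le>n. \<epsilon> l \<omega> * r i l\<bar>)) \<le> (1 + real m * \<mu>) * (\<Prod>i<m. L2_set (r i) {..n})"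
    \<comment> \<open>A form of norm 0 cannot be normalised, but then both sides vanish.\<close>
    proof (cases "\<exists>i<m. s i = 0")
      case True
      then obtain i where i: "i < m" "s i = 0" by blast
      hence "(\<Sum>l\<le>n. \<epsilon> l \<omega> * r i l) = 0" for \<omega>
        by (auto simp: s_def L2_set_eq_0_iff)
      hence lhs: "(\<Prod>i<m. \<bar>\<Sum>l\<le>n. \<epsilon> l \<omega> * r i l\<bar>) = 0" for \<omega>
        using i by (auto intro!: prod_zero)
      have rhs: "(\<Prod>i<m. L2_set (r i) {..n}) = 0"
        using i by (auto simp: s_def)
      show ?thesis unfolding lhs rhs by simp
    next
      case False
      have pos: "0 < s i" if "i < m" for i
        using False that L2_set_nonneg[of "r i" "{..n}"] by (auto simp: s_def order_less_le)
      have D: "distributed M lborel (g i) std_normal_density" if "i < m" for i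
        using normalized_combination_std_normal[OF iid, of "r i"] pos[OF that]
        by (simp add: g_def[abs_def] s_def)
      have int: "integrable M (\<lambda>\<omega>. \<bar>g i \<omega>\<bar> ^ m)" if "i < m" for i
        using distributed_integrable[OF D[OF that], of "\<lambda>x. \<bar>x\<bar> ^ m"]
          integrable_std_normal_moment_abs[of m] by simp
      have mom: "(LINT \<omega>|M. \<bar>g i \<omega>\<bar> ^ m) = \<mu>" if "i < m" for i
        using distributed_integral[OF D[OF that], of "\<lambda>x. \<bar>x\<bar> ^ m"] by (simp add: \<mu>_def)
      have "(\<Prod>i<m. \<bar>\<Sum>l\<le>n. \<epsilon> l \<omega> * r i l\<bar>) = (\<Prod>i<m. s i) * (\<Prod>i<m. \<bar>g i \<omega>\<bar>)" for \<omega>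
        unfolding prod.distrib[symmetric]
      proof (intro prod.cong refl)
        fix i assume "i \<in> {..<m}"
        hence "0 < s i" using pos by simp
        thus "\<bar>\<Sum>l\<le>n. \<epsilon> l \<omega> * r i l\<bar> = s i * \<bar>g i \<omega>\<bar>"
          by (simp add: g_def)
      qed
      hence "(LINT \<omega>|M. (\<Prod>i<m. \<bar>\<Sum>l\<le>n. \<epsilon> l \<omega> * r i l\<bar>)) =
          (LINT \<omega>|M. (\<Prod>i<m. \<bar>g i \<omega>\<bar>)) * (\<Prod>i<m. s i)"
        by (simp add: mult.commute)
      also have "\<dots> \<le> (1 + (\<Sum>i<m. LINT \<omega>|M. \<bar>g i \<omega>\<bar> ^ m)) * (\<Prod>i<m. s i)"
      proof (rule mult_right_mono)
        have sum_int: "integrable M (\<lambda>\<omega>. \<Sum>i<m. \<bar>g i \<omega>\<bar> ^ m)"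
          by (rule Bochner_Integration.integrable_sum) (simp add: int)
        have "(LINT \<omega>|M. (\<Prod>i<m. \<bar>g i \<omega>\<bar>)) \<le> (LINT \<omega>|M. 1 + (\<Sum>i<m. \<bar>g i \<omega>\<bar> ^ m))"
        proof (rule integral_mono')
          show "integrable M (\<lambda>\<omega>. 1 + (\<Sum>i<m. \<bar>g i \<omega>\<bar> ^ m))"
            using sum_int by simp
        qed (simp_all add: prod_abs_le_one_plus_sum_power add_nonneg_nonneg sum_nonneg)
        also have "\<dots> = 1 + (LINT \<omega>|M. (\<Sum>i<m. \<bar>g i \<omega>\<bar> ^ m))"
          by (subst Bochner_Integration.integral_add) (simp_all add: sum_int prob_space)
        also have "(LINT \<omega>|M. (\<Sum>i<m. \<bar>g i \<omega>\<bar> ^ m)) = (\<Sum>i<m. LINT \<omega>|M. \<bar>g i \<omega>\<bar> ^ m)"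
          by (rule Bochner_Integration.integral_sum) (simp add: int)
        finally show "(LINT \<omega>|M. (\<Prod>i<m. \<bar>g i \<omega>\<bar>)) \<le> 1 + (\<Sum>i<m. LINT \<omega>|M. \<bar>g i \<omega>\<bar> ^ m)" .
        show "0 \<le> (\<Prod>i<m. s i)"
          by (intro prod_nonneg) (simp add: s_def L2_set_nonneg)
      qed
      also have "1 + (\<Sum>i<m. LINT \<omega>|M. \<bar>g i \<omega>\<bar> ^ m) = 1 + real m * \<mu>"
        by (simp add: mom)
      finally show ?thesis
        by (simp add: s_def)
    qed
  qed
qed

section \<open>The zero density\<close>

text \<open>Conditioning on the value 0 evaluates \<open>f\<close> at \<open>U - A V\<close>, whose
  coefficient vectors \<open>r i\<close> are the residuals of \<open>b i\<close> modulo the span of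
  the \<open>a j\<close>.\<close>

lemma gaussian_cond_exp_eq_residual:
  assumes iid: "iid_std_gaussian M {0..n} \<epsilon>"
    and U: "\<And>i. U i = (\<lambda>\<omega>. \<Sum>l\<le>n. \<epsilon> l \<omega> * b i l)"
    and V: "\<And>i. V i = (\<lambda>\<omega>. \<Sum>l\<le>n. \<epsilon> l \<omega> * a i l)"
    and det: "Determinant.det (cov_mat M m V) \<noteq> 0"
  obtains A :: "nat \<Rightarrow> nat \<Rightarrow> real" and r
  where "\<And>i l. r i l = b i l - (\<Sum>j<m. A i j * a j l)"
    and "\<And>i p. i < m \<Longrightarrow> p < m \<Longrightarrow> (\<Sum>l\<le>n. r i l * a p l) = 0"
    and "\<And>f. gaussian_cond_exp M m U m V (\<lambda>_. 0) f = (LINT \<omega>|M. f (\<lambda>i. \<Sum>l\<le>n. \<epsilon> l \<omega> * r i l))"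
proof -
  define G H where "G = cov_mat M m V" and "H = cross_cov_mat M m U m V"
  have G: "G \<in> carrier_mat m m" and H: "H \<in> carrier_mat m m"
    by (simp_all add: G_def H_def cross_cov_mat_def)
  have G_entry: "G $$ (i, j) = (\<Sum>l\<le>n. a i l * a j l)" if "i < m" "j < m" for i j
    using that covariance_linear_combination[OF iid] by (simp add: G_def cross_cov_mat_def V)
  have H_entry: "H $$ (i, j) = (\<Sum>l\<le>n. b i l * a j l)" if "i < m" "j < m" for i j
    using that covariance_linear_combination[OF iid] by (simp add: H_def cross_cov_mat_def U V)
  \<comment> \<open>The instance for \<open>b\<close> only fills the extension slot of the matrix
    ring record.\<close>
  have "mat_inverse G \<noteq> None"
    using mat_inverse(1)[OF G, where b = "()"] det_non_zero_imp_unit[OF G, where b = "()"] det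
    by (auto simp: G_def)
  then obtain B where inv: "mat_inverse G = Some B" by blast
  from mat_inverse(2)[OF G inv] have B: "B * G = 1\<^sub>m m" "B \<in> carrier_mat m m" by auto
  define A where "A = H * B"
  \<comment> \<open>These are the normal equations, from which the orthogonality of the residuals
    follows.\<close>
  have "A * G = H"
    using assoc_mult_mat[OF H B(2) G] B(1) H by (simp add: A_def)
  have A: "A \<in> carrier_mat m m" using H B by (simp add: A_def)
  define r where "r i l = b i l - (\<Sum>j<m. A $$ (i, j) * a j l)" for i l
  have orth: "(\<Sum>l\<le>n. r i l * a p l) = 0" if "i < m" "p < m" for i p
  proof -
    have "(\<Sum>l\<le>n. r i l * a p l) = H $$ (i, p) - (\<Sum>j<m. A $$ (i, j) * G $$ (j, p))"
    proof -
      have "(\<Sum>l\<le>n. (\<Sum>j<m. A $$ (i, j) * a j l) * a p l) =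
          (\<Sum>j<m. A $$ (i, j) * (\<Sum>l\<le>n. a j l * a p l))"
        unfolding sum_distrib_left sum_distrib_right by (subst sum.swap) (simp add: mult.assoc)
      thus ?thesis
        using that by (simp add: r_def left_diff_distrib sum_subtractf G_entry H_entry)
    qed
    also have "(\<Sum>j<m. A $$ (i, j) * G $$ (j, p)) = (A * G) $$ (i, p)"
      using that A G by (auto simp: scalar_prod_def lessThan_atLeast0)
    finally show ?thesis by (simp add: \<open>A * G = H\<close>)
  qed
  have "U i \<omega> + (\<Sum>j<m. A $$ (i, j) * (0 - V j \<omega>)) = (\<Sum>l\<le>n. \<epsilon> l \<omega> * r i l)" for i \<omega>
  proof -
    have "(\<Sum>j<m. A $$ (i, j) * V j \<omega>) = (\<Sum>l\<le>n. \<epsilon> l \<omega> * (\<Sum>j<m. A $$ (i, j) * a j l))"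
      unfolding V sum_distrib_left by (subst sum.swap) (simp add: mult.left_commute)
    thus ?thesis
      by (simp add: U r_def right_diff_distrib sum_subtractf sum_negf)
  qed
  hence "gaussian_cond_exp M m U m V (\<lambda>_. 0) f = (LINT \<omega>|M. f (\<lambda>i. \<Sum>l\<le>n. \<epsilon> l \<omega> * r i l))" for f
    by (simp add: gaussian_cond_exp_def A_def G_def[symmetric] H_def[symmetric] inv)
  with r_def orth show thesis
    using that[of r "\<lambda>i j. A $$ (i, j)"] by blast
qed

text \<open>The cosines come first, so the Gram-Schmidt vector of a cosine involves only cosines,
  and only those of the sines mix both kinds.\<close>

definition value_coeff :: "nat \<Rightarrow> (nat \<Rightarrow> real) \<Rightarrow> (nat \<Rightarrow> real) \<Rightarrow> nat \<Rightarrow> nat \<Rightarrow> real" where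
  "value_coeff k x y i l = (if i < k then cos (real l * x i) else sin (real l * y (i - k)))"

definition deriv_coeff :: "nat \<Rightarrow> (nat \<Rightarrow> real) \<Rightarrow> (nat \<Rightarrow> real) \<Rightarrow> nat \<Rightarrow> nat \<Rightarrow> real" where
  "deriv_coeff k x y i l =
     (if i < k then - (real l * sin (real l * x i)) else real l * cos (real l * y (i - k)))"

lemma value_vec_eq: "value_vec n \<epsilon> k x y i = (\<lambda>\<omega>. \<Sum>l\<le>n. \<epsilon> l \<omega> * value_coeff k x y i l)"
  by (auto simp: value_vec_def value_coeff_def cos_poly_def sin_poly_def atLeast0AtMost)

lemma deriv_vec_eq: "deriv_vec n \<epsilon> k x y i = (\<lambda>\<omega>. \<Sum>l\<le>n. \<epsilon> l \<omega> * deriv_coeff k x y i l)"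
proof -
  have "((\<lambda>t. \<Sum>l\<le>n. \<epsilon> l \<omega> * cos (real l * t)) has_field_derivative
      (\<Sum>l\<le>n. \<epsilon> l \<omega> * - (real l * sin (real l * t)))) (at t)" for \<omega> t
    by (intro DERIV_sum) (auto intro!: derivative_eq_intros)
  moreover have "((\<lambda>t. \<Sum>l\<le>n. \<epsilon> l \<omega> * sin (real l * t)) has_field_derivative
      (\<Sum>l\<le>n. \<epsilon> l \<omega> * (real l * cos (real l * t)))) (at t)" for \<omega> t
    by (intro DERIV_sum) (auto intro!: derivative_eq_intros)
  ultimately show ?thesis
    by (auto simp: deriv_vec_def deriv_coeff_def cos_poly_def sin_poly_def atLeast0AtMost DERIV_imp_deriv)
qed

lemma T0_imp_interior:
  assumes "t \<in> T0 n"
  shows "0 < t" "t < pi"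
proof -
  have "0 \<le> real n powr (-1/2)" by simp
  with assms have "infdist t {0, pi} \<noteq> 0" "0 \<le> t" "t \<le> pi"
    by (auto simp: T0_def)
  thus "0 < t" "t < pi"
    by (auto simp: less_le)
qed

lemma prod_lessThan_add: "(\<Prod>i<k + m. f i) = (\<Prod>i<k. f i) * (\<Prod>i<m. f (k + i))"
  for f :: "nat \<Rightarrow> 'b::comm_monoid_mult"
  by (induction m) (simp_all add: mult.assoc)

lemma sum_lessThan_add: "(\<Sum>i<k + m. f i) = (\<Sum>i<k. f i) + (\<Sum>i<m. f (k + i))"
  for f :: "nat \<Rightarrow> 'b::comm_monoid_add"
  by (induction m) (simp_all add: add.assoc)

lemma sqrt_prod: "sqrt (\<Prod>i<m. f i) = (\<Prod>i<m. sqrt (f i))" for m :: nat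
  by (induction m) (simp_all add: real_sqrt_mult)

text \<open>For a cosine row \<open>cos_residual_bound\<close> applies to the Gram-Schmidt vector
  itself; for a sine row \<open>sine_part_bound\<close> first discards the cosines at the cost of a
  factor \<open>C\<close>.\<close>

lemma residual_le_gram_schmidt:
  "\<exists>C>0. \<forall>n x y r. 1 \<le> n \<longrightarrow> 2 * k \<le> n \<longrightarrow> k \<le> 1 \<or> 4 * k \<le> n + 1 \<longrightarrow>
     (\<forall>i<k. 0 < x i \<and> x i < pi \<and> 0 < y i \<and> y i < pi) \<longrightarrow>
     (\<forall>i<k. \<forall>j<k. i \<noteq> j \<longrightarrow> x i \<noteq> x j \<and> y i \<noteq> y j) \<longrightarrow>
     (\<forall>i<2*k. (\<Sum>l\<le>n. (r i l)\<^sup>2) = (\<Sum>l\<le>n. r i l * deriv_coeff k x y i l)) \<longrightarrow>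
     (\<forall>i<2*k. \<forall>p<2*k. (\<Sum>l\<le>n. r i l * value_coeff k x y p l) = 0) \<longrightarrow>
     (\<forall>i<2*k. L2_set (r i) {..n} \<le> C * real n * L2_set (gram_schmidt_vec n (value_coeff k x y) i) {..n})"
proof -
  obtain C where "0 < C" and C: "\<forall>n x y \<alpha> \<beta>. 2 * k \<le> n \<longrightarrow> k \<le> 1 \<or> 4 * k \<le> n + 1 \<longrightarrow>
     L2_set (\<lambda>l. \<Sum>i<k. \<beta> i * sin (real l * y i)) {..n} \<le>
     C * L2_set (\<lambda>l. (\<Sum>i<k. \<alpha> i * cos (real l * x i)) + (\<Sum>i<k. \<beta> i * sin (real l * y i))) {..n}"
    using sine_part_bound[of k] by (elim exE conjE) (rule that)
  \<comment> \<open>The factor 4 comes from \<open>2 (n + 1) \<le> 4 n\<close> for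
    \<open>n \<ge> 1\<close>, and \<open>1 + C\<close> serves both kinds of rows.\<close>
  have "L2_set (r i) {..n} \<le> 4 * (1 + C) * real n * L2_set (gram_schmidt_vec n (value_coeff k x y) i) {..n}"
    if n: "1 \<le> n" "2 * k \<le> n" "k \<le> 1 \<or> 4 * k \<le> n + 1"
      and int: "\<And>i. i < k \<Longrightarrow> 0 < x i \<and> x i < pi \<and> 0 < y i \<and> y i < pi"
      and dist: "\<And>i j. i < k \<Longrightarrow> j < k \<Longrightarrow> i \<noteq> j \<Longrightarrow> x i \<noteq> x j \<and> y i \<noteq> y j"
      and rr: "\<And>i. i < 2 * k \<Longrightarrow> (\<Sum>l\<le>n. (r i l)\<^sup>2) = (\<Sum>l\<le>n. r i l * deriv_coeff k x y i l)"
      and ra: "\<And>i p. i < 2 * k \<Longrightarrow> p < 2 * k \<Longrightarrow> (\<Sum>l\<le>n. r i l * value_coeff k x y p l) = 0"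
      and i: "i < 2 * k" for n x y r i
  proof -
    let ?a = "value_coeff k x y"
    let ?q = "L2_set (gram_schmidt_vec n ?a i) {..n}"
    obtain c where c: "\<And>l. gram_schmidt_vec n ?a i l = ?a i l - (\<Sum>j<i. c j * ?a j l)"
      using gram_schmidt_vec_span by blast
    have rcos: "(\<Sum>l\<le>n. r i l * cos (real l * x p)) = 0" if "p < k" for p
      using ra[OF i, of p] that by (simp add: value_coeff_def)
    have rsin: "(\<Sum>l\<le>n. r i l * sin (real l * y p)) = 0" if "p < k" for p
      using ra[OF i, of "k + p"] that by (simp add: value_coeff_def)
    show ?thesis
    proof (cases "i < k")
      case True
      have "?q = L2_set (\<lambda>l. cos (real l * x i) - (\<Sum>j\<in>{..<i}. c j * cos (real l * x j))) {..n}"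
        using True by (intro L2_set_cong refl) (simp add: c value_coeff_def)
      hence "L2_set (r i) {..n} \<le> 2 * (real n + 1) * ?q"
        using cos_residual_bound[of "x i" "{..<i}" x "r i" n c] True int dist rcos rr[OF i]
        by (simp add: deriv_coeff_def)
      also have "\<dots> \<le> 4 * (1 + C) * real n * ?q"
      proof (intro mult_right_mono L2_set_nonneg)
        have "0 \<le> C * real n" using \<open>0 < C\<close> by simp
        thus "2 * (real n + 1) \<le> 4 * (1 + C) * real n"
          using n(1) by (simp add: algebra_simps)
      qed
      finally show ?thesis .
    next
      case False
      define p where "p = i - k"
      have p: "i = k + p" "p < k" using False i by (auto simp: p_def)
      \<comment> \<open>The sine coefficients of the Gram-Schmidt vector are extended by zeros to
        all \<open>k\<close> sines.\<close>
      define \<beta> where "\<beta> j = (if j = p then 1 else if j < p then - c (k + j) else 0)" for j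
      define s where "s l = sin (real l * y p) - (\<Sum>j\<in>{..<p}. c (k + j) * sin (real l * y j))" for l
      have s: "(\<Sum>j<k. \<beta> j * sin (real l * y j)) = s l" for l
      proof -
        have "(\<Sum>j<k. \<beta> j * sin (real l * y j)) = (\<Sum>j<Suc p. \<beta> j * sin (real l * y j))"
          using p by (intro sum.mono_neutral_right) (auto simp: \<beta>_def)
        thus ?thesis by (simp add: \<beta>_def s_def sum_negf)
      qed
      have q: "gram_schmidt_vec n ?a i l =
          (\<Sum>j<k. - c j * cos (real l * x j)) + (\<Sum>j<k. \<beta> j * sin (real l * y j))" for l
        unfolding c s by (simp add: p(1) sum_lessThan_add value_coeff_def s_def sum_negf)
      have "L2_set (\<lambda>l. \<Sum>j<k. \<beta> j * sin (real l * y j)) {..n} \<le> C * L2_set (\<lambda>l.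
          (\<Sum>j<k. - c j * cos (real l * x j)) + (\<Sum>j<k. \<beta> j * sin (real l * y j))) {..n}"
        by (rule C[rule_format, OF n(2,3)])
      hence s_le: "L2_set s {..n} \<le> C * ?q"
        unfolding s q .
      have "L2_set (r i) {..n} \<le> 2 * (real n + 1) * L2_set s {..n}"
        unfolding s_def using p int dist rsin rr[OF i]
        by (intro sin_residual_bound) (auto simp: deriv_coeff_def)
      also have "\<dots> \<le> 2 * (real n + 1) * (C * ?q)"
        using s_le by (rule mult_left_mono) simp
      also have "\<dots> = 2 * (real n + 1) * C * ?q"
        by simp
      also have "\<dots> \<le> 4 * (1 + C) * real n * ?q"
      proof (intro mult_right_mono L2_set_nonneg)
        show "2 * (real n + 1) * C \<le> 4 * (1 + C) * real n"
          using mult_mono[of "2 * (real n + 1)" "4 * real n" C "1 + C"] n(1) \<open>0 < C\<close>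
          by (simp add: mult_ac)
      qed
      finally show ?thesis .
    qed
  qed
  thus ?thesis
    using \<open>0 < C\<close> by (intro exI[of _ "4 * (1 + C)"]) auto
qed

text \<open>For \<open>k \<ge> 2\<close> the condition on \<open>n\<close> leaves out exactly
  \<open>2 k \<le> n \<le> 4 k - 2\<close>, where \<Sigma> can be singular at distinct points; the
  example at \<open>zero_density\<close> for \<open>k = 2\<close>, \<open>n = 4\<close> shows an
  unbounded quotient there.\<close>

theorem lemma19:
  fixes k :: nat
  shows "\<exists>C::real. C > 0 \<and>
    (\<forall>(n::nat) (M :: 'a measure) (\<epsilon> :: nat \<Rightarrow> 'a \<Rightarrow> real).
       n \<ge> 1 \<longrightarrow> (k \<le> 1 \<or> n < 2 * k \<or> 4 * k \<le> n + 1) \<longrightarrow>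
       iid_std_gaussian M {0..n} \<epsilon> \<longrightarrow>
       (\<forall>x y :: nat \<Rightarrow> real.
          (\<forall>i<k. x i \<in> T0 n \<and> y i \<in> T0 n) \<longrightarrow>
          zero_density M n \<epsilon> k x y \<le> C * real n ^ (2 * k)))"
proof -
  obtain K where "0 < K" and K: "\<forall>n (M :: 'a measure) \<epsilon> r. iid_std_gaussian M {0..n} \<epsilon> \<longrightarrow>
      (LINT \<omega>|M. (\<Prod>i<2 * k. \<bar>\<Sum>l\<le>n. \<epsilon> l \<omega> * r i l\<bar>)) \<le> K * (\<Prod>i<2 * k. L2_set (r i) {..n})"
    using gaussian_abs_product_bound[of "2 * k", where 'a = 'a] by (elim exE conjE) (rule that)
  obtain C where "0 < C" and C: "\<forall>n x y r. 1 \<le> n \<longrightarrow> 2 * k \<le> n \<longrightarrow> k \<le> 1 \<or> 4 * k \<le> n + 1 \<longrightarrow>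
     (\<forall>i<k. 0 < x i \<and> x i < pi \<and> 0 < y i \<and> y i < pi) \<longrightarrow>
     (\<forall>i<k. \<forall>j<k. i \<noteq> j \<longrightarrow> x i \<noteq> x j \<and> y i \<noteq> y j) \<longrightarrow>
     (\<forall>i<2*k. (\<Sum>l\<le>n. (r i l)\<^sup>2) = (\<Sum>l\<le>n. r i l * deriv_coeff k x y i l)) \<longrightarrow>
     (\<forall>i<2*k. \<forall>p<2*k. (\<Sum>l\<le>n. r i l * value_coeff k x y p l) = 0) \<longrightarrow>
     (\<forall>i<2*k. L2_set (r i) {..n} \<le> C * real n * L2_set (gram_schmidt_vec n (value_coeff k x y) i) {..n})"
    using residual_le_gram_schmidt[of k] by (elim exE conjE) (rule that)
  have "zero_density M n \<epsilon> k x y \<le> K * C ^ (2 * k) * real n ^ (2 * k)"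
    if n: "1 \<le> n" and cond: "k \<le> 1 \<or> n < 2 * k \<or> 4 * k \<le> n + 1"
      and iid: "iid_std_gaussian M {0..n} \<epsilon>"
      and T0: "\<And>i. i < k \<Longrightarrow> x i \<in> T0 n \<and> y i \<in> T0 n"
    for n x y and M :: "'a measure" and \<epsilon>
  proof -
    let ?V = "value_vec n \<epsilon> k x y" and ?U = "deriv_vec n \<epsilon> k x y"
    let ?a = "value_coeff k x y" and ?b = "deriv_coeff k x y"
    let ?q = "\<lambda>i. L2_set (gram_schmidt_vec n ?a i) {..n}"
    define \<Delta> where "\<Delta> = Determinant.det (cov_mat M (2 * k) ?V)"
    have \<Delta>_gram: "\<Delta> = Determinant.det (Matrix.mat (2 * k) (2 * k) (\<lambda>(i, j). \<Sum>l\<le>n. ?a i l * ?a j l))"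
      by (simp add: \<Delta>_def cross_cov_mat_def value_vec_eq covariance_linear_combination[OF iid])
    have sqrt_\<Delta>: "sqrt \<Delta> = (\<Prod>i<2 * k. ?q i)"
      by (simp add: \<Delta>_gram det_gram_eq_prod L2_set_def sqrt_prod)
    have rhs: "0 \<le> K * C ^ (2 * k) * real n ^ (2 * k)"
      using \<open>0 < K\<close> \<open>0 < C\<close> by simp
    show ?thesis
    \<comment> \<open>In the first case the value is 0, by the convention for coinciding points or
      by division by zero.\<close>
    proof (cases "(\<exists>i<k. \<exists>j<k. i \<noteq> j \<and> (x i = x j \<or> y i = y j)) \<or> \<Delta> = 0")
      case True
      thus ?thesis using rhs by (auto simp: zero_density_def \<Delta>_def[symmetric])
    next
      case False
      hence dist: "\<And>i j. i < k \<Longrightarrow> j < k \<Longrightarrow> i \<noteq> j \<Longrightarrow> x i \<noteq> x j \<and> y i \<noteq> y j"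
        and "\<Delta> \<noteq> 0" by auto
      obtain A r where r: "\<And>i l. r i l = ?b i l - (\<Sum>j<2 * k. A i j * ?a j l)"
        and orth: "\<And>i p. i < 2 * k \<Longrightarrow> p < 2 * k \<Longrightarrow> (\<Sum>l\<le>n. r i l * ?a p l) = 0"
        and cond_exp: "\<And>f. gaussian_cond_exp M (2 * k) ?U (2 * k) ?V (\<lambda>_. 0) f =
            (LINT \<omega>|M. f (\<lambda>i. \<Sum>l\<le>n. \<epsilon> l \<omega> * r i l))"
      proof (rule gaussian_cond_exp_eq_residual[where U = ?U and b = ?b and V = ?V and a = ?a
            and m = "2 * k", OF iid deriv_vec_eq value_vec_eq])
        show "Determinant.det (cov_mat M (2 * k) ?V) \<noteq> 0"
          using \<open>\<Delta> \<noteq> 0\<close> unfolding \<Delta>_def .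
      qed (rule that)
      \<comment> \<open>The difference \<open>?b i - r i\<close> lies in the span of the
        \<open>?a j\<close>, to which \<open>r i\<close> is orthogonal.\<close>
      have rr: "(\<Sum>l\<le>n. (r i l)\<^sup>2) = (\<Sum>l\<le>n. r i l * ?b i l)" if "i < 2 * k" for i
      proof -
        have "(\<Sum>l\<le>n. r i l * (\<Sum>j<2 * k. A i j * ?a j l)) = (\<Sum>j<2 * k. A i j * (\<Sum>l\<le>n. r i l * ?a j l))"
          unfolding sum_distrib_left by (subst sum.swap) (simp add: mult.left_commute)
        also have "\<dots> = 0" using orth that by simp
        finally have "(\<Sum>l\<le>n. r i l * (?b i l - r i l)) = 0"
          using r by simp
        thus ?thesis by (simp add: right_diff_distrib sum_subtractf power2_eq_square)
      qed
      have le: "L2_set (r i) {..n} \<le> C * real n * ?q i" if i: "i < 2 * k" for i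
      \<comment> \<open>For \<open>n < 2 k\<close> a regular \<Sigma> means that the
        \<open>?a j\<close> span all vectors on \<open>{..n}\<close>, so the residuals
        vanish.\<close>
      proof (cases "n < 2 * k")
        case True
        have "r i l = 0" if "l \<le> n" for l
          using orthogonal_eq_0_if_gram_det_nonzero[OF True, of ?a "r i"] \<open>\<Delta> \<noteq> 0\<close> orth[OF i] that
          by (simp add: \<Delta>_gram)
        hence "L2_set (r i) {..n} = 0" by (simp add: L2_set_eq_0_iff)
        thus ?thesis using \<open>0 < C\<close> by (simp add: L2_set_nonneg)
      next
        case False
        hence "2 * k \<le> n" "k \<le> 1 \<or> 4 * k \<le> n + 1"
          using cond by auto
        moreover have "0 < x i \<and> x i < pi \<and> 0 < y i \<and> y i < pi" if "i < k" for i
          using T0[OF that] T0_imp_interior by blast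
        ultimately show ?thesis
          using C[rule_format, of n x y r i] n dist rr orth i by blast
      qed
      have pos: "0 < (\<Prod>i<2 * k. ?q i)"
      proof -
        have "0 \<le> (\<Prod>i<2 * k. ?q i)" by (intro prod_nonneg L2_set_nonneg)
        moreover have "(\<Prod>i<2 * k. ?q i) \<noteq> 0" unfolding sqrt_\<Delta>[symmetric] using \<open>\<Delta> \<noteq> 0\<close> by simp
        ultimately show ?thesis by (simp only: less_le) simp
      qed
      have split: "(\<Prod>j<k. \<bar>u j\<bar> * \<bar>u (k + j)\<bar>) = (\<Prod>i<2 * k. \<bar>u i\<bar>)" for u :: "nat \<Rightarrow> real"
        by (simp add: mult_2 prod_lessThan_add prod.distrib)
      have "gaussian_cond_exp M (2 * k) ?U (2 * k) ?V (\<lambda>_. 0) (\<lambda>u. \<Prod>j<k. \<bar>u j\<bar> * \<bar>u (k + j)\<bar>) =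
          (LINT \<omega>|M. (\<Prod>i<2 * k. \<bar>\<Sum>l\<le>n. \<epsilon> l \<omega> * r i l\<bar>))"
        unfolding split cond_exp ..
      also have "\<dots> \<le> K * (\<Prod>i<2 * k. L2_set (r i) {..n})"
        by (rule K[rule_format, OF iid])
      also have "\<dots> \<le> K * (\<Prod>i<2 * k. C * real n * ?q i)"
        using le \<open>0 < K\<close> by (intro mult_left_mono prod_mono) (auto simp: L2_set_nonneg)
      also have "\<dots> = K * C ^ (2 * k) * real n ^ (2 * k) * sqrt \<Delta>"
        by (simp add: prod.distrib power_mult_distrib sqrt_\<Delta>)
      finally have num: "gaussian_cond_exp M (2 * k) ?U (2 * k) ?V (\<lambda>_. 0) (\<lambda>u. \<Prod>j<k. \<bar>u j\<bar> * \<bar>u (k + j)\<bar>)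
          \<le> K * C ^ (2 * k) * real n ^ (2 * k) * sqrt \<Delta>" .
      \<comment> \<open>The factor \<open>(2 * pi) ^ k\<close> of the denominator is at least 1, so
        it is absorbed without changing the constant.\<close>
      have "1 \<le> (2 * pi) ^ k"
        using pi_ge_two by (intro one_le_power) simp
      hence "K * C ^ (2 * k) * real n ^ (2 * k) * sqrt \<Delta> * 1 \<le>
          K * C ^ (2 * k) * real n ^ (2 * k) * sqrt \<Delta> * (2 * pi) ^ k"
        using rhs pos unfolding sqrt_\<Delta> by (intro mult_left_mono) auto
      with num have "gaussian_cond_exp M (2 * k) ?U (2 * k) ?V (\<lambda>_. 0) (\<lambda>u. \<Prod>j<k. \<bar>u j\<bar> * \<bar>u (k + j)\<bar>)
          \<le> K * C ^ (2 * k) * real n ^ (2 * k) * ((2 * pi) ^ k * sqrt \<Delta>)"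
        by (simp add: mult_ac)
      moreover have "0 < (2 * pi) ^ k * sqrt \<Delta>"
        using pos by (simp add: sqrt_\<Delta>)
      ultimately show ?thesis
        using False by (auto simp: zero_density_def \<Delta>_def[symmetric] pos_divide_le_eq)
    qed
  qed
  thus ?thesis
    using \<open>0 < K\<close> \<open>0 < C\<close> by (intro exI[of _ "K * C ^ (2 * k)"]) auto
qed

end
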